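(* Let $E\subset\mathbb{R}^4$ be a totally irrational $2$-dimensional plane which is characterized by its subperiods $p_0,p_1,p_2,p_3$ and admits a fine projection $\pi:\mathbb{R}^4\to\mathbb{R}^2$. Then the FP-tileset obtained from $E$ and $\pi$ is aperiodic: the plane can be tiled by its decorated tiles (with the Ammann bar rule), but no such tiling is periodic.
   Context: Tilings by parallelograms: fix pairwise non-collinear $v_0,\dots,v_3\in\mathbb{R}^2$ and prototiles $T_{ij}=\{\lambda v_i+\mu v_j: 0\le\lambda,\mu\le 1\}$; a tiling uses translates only (no rotations or reflections), and is edge-to-edge (two tiles meet in the empty set, a vertex, or a whole edge). Such a tiling lifts (uniquely up to the choice of an initial vertex) to a stepped $2$-dimensional surface in $\mathbb{R}^4$: a chosen vertex goes to the origin, a tile $T_{ij}$ goes to a $2$-face of a unit hypercube of $\mathbb{Z}^4$ spanned by $e_i,e_j$ (standard basis), and tiles adjacent along an edge $v_i$ go to faces adjacent along an edge $e_i$. The tiling is planar with slope $E$ (a $2$-plane) if its lift lies in $E+[0,t]^4$ for some $t\ge1$. Canonical cut and project ($4\to2$) tiling with slope $E$: for an affine $2$-plane $E$ with $E\cap\mathbb{Z}^4=\emptyset$, take all $2$-faces of the integer lattice $\mathbb{Z}^4$ lying in $E+[0,1]^4$ and map them by a linear map $\pi:\mathbb{R}^4\to\mathbb{R}^2$; $\pi$ is valid if the images form a tiling of $\mathbb{R}^2$. The $i$-shadow of a tiling is the image of its lift under the orthogonal projection $\omega_i$ onto $\mathrm{span}\{e_j: j\ne i\}\cong\mathbb{R}^3$.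 An $i$-subperiod of a $4\to2$ tiling is a prime (integer) period of its $i$-shadow; a subperiod $p_i$ of the slope $E$ is a vector of $E$ whose image $\omega_i(p_i)$ is an $i$-subperiod (so $p_i$ has integer coordinates in all positions $j\neq i$). $E$ is characterized by its subperiods if it has subperiods $p_0,\dots,p_3$ and only finitely many $2$-planes have the same subperiods (same integer coordinates). A fine projection for $E$ is a valid projection $\pi$ such that $\pi(p_i)$ and $\pi(e_i)$ are collinear for every $i\in\{0,1,2,3\}$. $E$ is totally irrational if it contains no rational line. FP-method: given such $E$ (irrational, characterized by subperiods) and a fine projection $\pi$, take a $4\to2$ tiling with slope $E$ obtained via $\pi$, draw through every vertex the four lines directed by $\pi(p_0),\dots,\pi(p_3)$; each tile thus carries segments (Ammann segments); the set of all decorated tiles up to translation is the FP-tileset. A tiling by an FP-tileset means an edge-to-edge tiling by translates of these decorated tiles such that every Ammann segment is continued on adjacent tiles so that the segments form full straight lines (Ammann bar rule). *)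

theory Defs
  imports "HOL-Analysis.Analysis"
begin

section \<open>Canonical cut and project tilings\<close>

definition integer_lattice :: "(real^4) set" where
  "integer_lattice = {x. \<forall>k. x $ k \<in> \<int>}"

definition unit_cube :: "(real^4) set" where
  "unit_cube = {x. \<forall>k. 0 \<le> x $ k \<and> x $ k \<le> 1}"

definition two_face :: "real^4 \<Rightarrow> 4 \<Rightarrow> 4 \<Rightarrow> (real^4) set" where
  "two_face x i j =
     {x + a *\<^sub>R axis i 1 + b *\<^sub>R axis j 1 | a b. 0 \<le> a \<and> a \<le> 1 \<and> 0 \<le> b \<and> b \<le> 1}"

definition selected_faces :: "(real^4) set \<Rightarrow> (real^4) set set" where
  "selected_faces F =
     {two_face x i j | x i j. x \<in> integer_lattice \<and> i \<noteq> j \<and>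
        two_face x i j \<subseteq> {y + c | y c. y \<in> F \<and> c \<in> unit_cube}}"

text \<open>Tiles are closed subsets of the plane, and a tiling is the set of its tiles. In all uses below
  the tiles are parallelograms, whose vertices and edges are their extreme points and their
  one-dimensional faces.\<close>

definition edge_to_edge :: "(real^2) set \<Rightarrow> (real^2) set \<Rightarrow> bool" where
  "edge_to_edge A B \<longleftrightarrow>
     A \<inter> B = {} \<or>
     (\<exists>x. A \<inter> B = {x} \<and> x extreme_point_of A \<and> x extreme_point_of B) \<or>
     (A \<inter> B edge_of A \<and> A \<inter> B edge_of B)"

definition plane_tiling :: "(real^2) set set \<Rightarrow> bool" where
  "plane_tiling \<T> \<longleftrightarrow> \<Union>\<T> = UNIV \<and> (\<forall>A\<in>\<T>. \<forall>B\<in>\<T>. A \<noteq> B \<longrightarrow> edge_to_edge A B)"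

definition projected_tiles :: "(real^4) set \<Rightarrow> (real^4 \<Rightarrow> real^2) \<Rightarrow> (real^2) set set" where
  "projected_tiles F \<pi> = (\<lambda>f. \<pi> ` f) ` selected_faces F"

text \<open>Here \<open>F\<close> is an affine plane. Injectivity says that no tile is covered twice, which a set of
  tiles cannot express by itself.\<close>

definition projects_to_tiling :: "(real^4) set \<Rightarrow> (real^4 \<Rightarrow> real^2) \<Rightarrow> bool" where
  "projects_to_tiling F \<pi> \<longleftrightarrow>
     F \<inter> integer_lattice = {} \<and>
     inj_on (\<lambda>f. \<pi> ` f) (selected_faces F) \<and>
     plane_tiling (projected_tiles F \<pi>)"

text \<open>The slope \<open>E\<close> is a linear plane; the tilings with slope \<open>E\<close> come from the affine planes
  parallel to \<open>E\<close>.\<close>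

definition cut_and_project_tilings :: "(real^4) set \<Rightarrow> (real^4 \<Rightarrow> real^2) \<Rightarrow> (real^2) set set set" where
  "cut_and_project_tilings E \<pi> =
     {projected_tiles ((+) s ` E) \<pi> | s. projects_to_tiling ((+) s ` E) \<pi>}"

definition valid_projection :: "(real^4) set \<Rightarrow> (real^4 \<Rightarrow> real^2) \<Rightarrow> bool" where
  "valid_projection E \<pi> \<longleftrightarrow>
     linear \<pi> \<and>
     (\<forall>i j. i \<noteq> j \<longrightarrow> \<not> collinear {0, \<pi> (axis i 1), \<pi> (axis j 1)}) \<and>
     cut_and_project_tilings E \<pi> \<noteq> {}"

section \<open>Shadows and subperiods\<close>

definition two_plane :: "(real^4) set \<Rightarrow> bool" where
  "two_plane E \<longleftrightarrow> subspace E \<and> dim E = 2"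

definition totally_irrational :: "(real^4) set \<Rightarrow> bool" where
  "totally_irrational E \<longleftrightarrow> \<not> (\<exists>v\<in>E. v \<noteq> 0 \<and> (\<forall>k. v $ k \<in> \<rat>))"

definition omit_coord :: "4 \<Rightarrow> real^4 \<Rightarrow> real^4" where
  "omit_coord i x = (\<chi> k. if k = i then 0 else x $ k)"

text \<open>The lift of a cut and project tiling is the union of the selected faces; the choice of the
  initial vertex only translates it by a lattice vector, which does not affect periods.\<close>

definition shadow :: "4 \<Rightarrow> (real^4) set \<Rightarrow> (real^4) set" where
  "shadow i F = omit_coord i ` \<Union>(selected_faces F)"

definition prime_period :: "(real^4) set \<Rightarrow> real^4 \<Rightarrow> bool" where
  "prime_period S q \<longleftrightarrow>
     (+) q ` S = S \<and> q \<in> integer_lattice \<and> Gcd (range (\<lambda>k. \<lfloor>q $ k\<rfloor>)) = 1"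

definition subperiod :: "(real^4) set \<Rightarrow> 4 \<Rightarrow> real^4 \<Rightarrow> bool" where
  "subperiod E i p \<longleftrightarrow>
     p \<in> E \<and>
     (\<forall>s. ((+) s ` E) \<inter> integer_lattice = {} \<longrightarrow>
        prime_period (shadow i ((+) s ` E)) (omit_coord i p))"

definition characterized_by_subperiods :: "(real^4) set \<Rightarrow> (4 \<Rightarrow> real^4) \<Rightarrow> bool" where
  "characterized_by_subperiods E p \<longleftrightarrow>
     (\<forall>i. subperiod E i (p i)) \<and>
     finite {E'. two_plane E' \<and>
       (\<exists>p'. \<forall>i. subperiod E' i (p' i) \<and> omit_coord i (p' i) = omit_coord i (p i))}"

definition fine_projection :: "(real^4) set \<Rightarrow> (4 \<Rightarrow> real^4) \<Rightarrow> (real^4 \<Rightarrow> real^2) \<Rightarrow> bool" where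
  "fine_projection E p \<pi> \<longleftrightarrow>
     valid_projection E \<pi> \<and> (\<forall>i. collinear {0, \<pi> (p i), \<pi> (axis i 1)})"

section \<open>Decorated tiles and Ammann bars\<close>

text \<open>A decorated tile is a tile together with the set of segments drawn on it.\<close>

type_synonym decorated_tile = "(real^2) set \<times> (real^2) set set"

definition translate_decorated :: "real^2 \<Rightarrow> decorated_tile \<Rightarrow> decorated_tile" where
  "translate_decorated t A = ((+) t ` fst A, (\<lambda>S. (+) t ` S) ` snd A)"

definition tiling_vertices :: "(real^2) set set \<Rightarrow> (real^2) set" where
  "tiling_vertices \<T> = {x. \<exists>T\<in>\<T>. x extreme_point_of T}"

definition vertex_lines :: "(4 \<Rightarrow> real^2) \<Rightarrow> (real^2) set set \<Rightarrow> (real^2) set set" where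
  "vertex_lines d \<T> = {{x + t *\<^sub>R d i | t. True} | x i. x \<in> tiling_vertices \<T>}"

text \<open>A line that meets a tile in a single point (necessarily a vertex) leaves no segment on it,
  whereas a line running along an edge does.\<close>

definition decorate :: "(4 \<Rightarrow> real^2) \<Rightarrow> (real^2) set set \<Rightarrow> (real^2) set \<Rightarrow> decorated_tile" where
  "decorate d \<T> T = (T, {L \<inter> T | L. L \<in> vertex_lines d \<T> \<and> \<not> (\<exists>x. L \<inter> T \<subseteq> {x})})"

text \<open>The tileset matters only up to translation, since tilings use arbitrary translates of its
  elements.\<close>

definition FP_tileset ::
    "(4 \<Rightarrow> real^4) \<Rightarrow> (real^4 \<Rightarrow> real^2) \<Rightarrow> (real^2) set set \<Rightarrow> decorated_tile set" where
  "FP_tileset p \<pi> \<T> = decorate (\<lambda>i. \<pi> (p i)) \<T> ` \<T>"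

text \<open>Each segment extends to a full straight line made up of segments of the tiling.\<close>

definition ammann_bar_rule :: "decorated_tile set \<Rightarrow> bool" where
  "ammann_bar_rule \<D> \<longleftrightarrow>
     (\<forall>A\<in>\<D>. \<forall>S\<in>snd A.
        affine hull S = \<Union>{S'. (\<exists>B\<in>\<D>. S' \<in> snd B) \<and> S' \<subseteq> affine hull S})"

definition decorated_tiling :: "decorated_tile set \<Rightarrow> decorated_tile set \<Rightarrow> bool" where
  "decorated_tiling X \<D> \<longleftrightarrow>
     (\<forall>A\<in>\<D>. \<exists>B\<in>X. \<exists>t. A = translate_decorated t B) \<and>
     inj_on fst \<D> \<and>
     plane_tiling (fst ` \<D>) \<and>
     ammann_bar_rule \<D>"

definition periodic :: "decorated_tile set \<Rightarrow> bool" where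
  "periodic \<D> \<longleftrightarrow> (\<exists>t. t \<noteq> 0 \<and> translate_decorated t ` \<D> = \<D>)"

definition aperiodic_tileset :: "decorated_tile set \<Rightarrow> bool" where
  "aperiodic_tileset X \<longleftrightarrow>
     (\<exists>\<D>. decorated_tiling X \<D>) \<and> (\<forall>\<D>. decorated_tiling X \<D> \<longrightarrow> \<not> periodic \<D>)"

end

theory Submission
  imports Defs
begin

text \<open>
  Write \<open>d i = \<pi> (p i)\<close> and \<open>\<pi> (e\<^sub>i) = \<kappa> i d i\<close>. The vectors \<open>k i = p i - e\<^sub>i / \<kappa> i\<close> lie in the kernel
  of \<open>\<pi>\<close>, which is a complement of \<open>E\<close>. Every linear map \<open>g\<close> with \<open>g (d i) \<in> \<real> k i\<close> for all \<open>i\<close> yields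
  the pencil of planes \<open>{v + s g (\<pi> v) | v \<in> E}\<close>, which all have the subperiods of \<open>E\<close>; finiteness
  therefore forces \<open>g = 0\<close>. A consequence is that \<open>\<pi>\<close> is injective on \<open>\<int>\<^sup>4\<close> and that a
  lattice vector projected to a multiple of \<open>d i\<close> lies in the span of \<open>p i\<close> and \<open>e\<^sub>i\<close>.

  Hence the vertices of any tiling by the decorated tiles have well-defined lattice coordinates, and
  along an Ammann bar of direction \<open>d i\<close> the projection of these coordinates to the kernel
  along \<open>E\<close> moves within bounded distance of the line \<open>\<real> k i\<close>. A period of the tiling lifts to a
  nonzero lattice vector, which is not in \<open>E\<close>. Comparing the bars through one vertex
  with their translates by multiples of the period shows that the projected coordinates are linear up to a
  bounded error, with a nonzero linear part \<open>g\<close> as above, a contradiction.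
\<close>

text \<open>Subperiods are defined through the shadows of all tilings with a given slope, whereas a
  deformed plane comes with nothing but vectors that have integer coordinates off position
  \<open>i\<close>. The shadow section bridges this gap: such a vector is a period of every shadow,
  so the finiteness hypothesis does count the deformed planes.

  Finiteness enters only through \<open>no_deformation\<close>, each time with an explicit
  \<open>g\<close>. Arithmetic is turned into such a \<open>g\<close> by a rational-linear
  functional: an unexpected coincidence among projected lattice vectors makes kernel vectors
  rational; then an irrational \<open>\<kappa>\<close> could be varied, while a rational
  \<open>\<kappa>\<close> would put a rational vector into \<open>E\<close>.

  An arbitrary tiling by the decorated tiles has no slope known in advance, and its tiles remember
  the original tiling only up to separate translations. No exact linear statement about its lift is
  at hand, so everything is done up to bounded error. The bars through a single vertex suffice
  because translation along the period carries their values to the whole plane.\<close>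

section \<open>Shadows of cut and project tilings\<close>

text \<open>Here \<open>{y. \<nu> \<bullet> y = h}\<close> is \<open>F + \<real> e\<^sub>i\<close>. The last condition says that it meets the segment from
  \<open>x - e\<^sub>c\<close> to \<open>x\<close>, which is equivalent to the face at \<open>x\<close> spanned by \<open>e\<^sub>a\<close>, \<open>e\<^sub>b\<close> having a translate
  along \<open>e\<^sub>i\<close> among the selected faces. It depends on \<open>x\<close> only through \<open>\<nu> \<bullet> x\<close>, hence is
  invariant under the lattice vectors orthogonal to \<open>\<nu>\<close>.\<close>

definition shadow_face :: "real^4 \<Rightarrow> real \<Rightarrow> 4 \<Rightarrow> real^4 \<Rightarrow> 4 \<Rightarrow> 4 \<Rightarrow> 4 \<Rightarrow> bool" where
  "shadow_face \<nu> h i x a b c \<longleftrightarrow>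
     x \<in> integer_lattice \<and> distinct [a, b, c, i] \<and>
     (\<exists>\<theta>. 0 \<le> \<theta> \<and> \<theta> \<le> 1 \<and> \<nu> \<bullet> x - \<theta> * \<nu> $ c = h)"

section \<open>Coordinates, lattice vectors and faces in four-space\<close>

lemma distinct_UNIV_4: "distinct [a, b, c, i :: 4] \<Longrightarrow> UNIV = {a, b, c, i}"
  by (rule sym, rule card_subset_eq) auto

lemma obtain_distinct_4:
  fixes i b :: 4
  assumes "b \<noteq> i"
  obtains c d where "distinct [b, c, d, i]"
proof -
  have "card (UNIV - {b, i}) = 2"
    using assms by (subst card_Diff_subset) auto
  then obtain c d where "UNIV - {b, i} = {c, d}" "c \<noteq> d"
    by (auto simp: card_2_iff)
  then have "distinct [b, c, d, i]" using assms by auto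
  then show ?thesis by (rule that)
qed

lemma obtain_fourth:
  fixes a b i :: 4
  assumes "a \<noteq> b" "a \<noteq> i" "b \<noteq> i"
  obtains c where "distinct [a, b, c, i]"
proof -
  have "card (UNIV - {a, b, i}) = 1"
    using assms by (subst card_Diff_subset) auto
  then obtain c where "UNIV - {a, b, i} = {c}"
    by (auto simp: card_1_singleton_iff)
  then have "distinct [a, b, c, i]" using assms by auto
  then show ?thesis by (rule that)
qed

lemma inner_distinct_4:
  fixes x y :: "real^4"
  assumes "distinct [a, b, c, i]"
  shows "x \<bullet> y = x $ a * y $ a + x $ b * y $ b + x $ c * y $ c + x $ i * y $ i"
  using assms unfolding inner_vec_def distinct_UNIV_4[OF assms] by simp

lemma all_distinct_4:
  assumes "distinct [a, b, c, i :: 4]"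
  shows "(\<forall>k. P k) \<longleftrightarrow> P a \<and> P b \<and> P c \<and> P i"
  using distinct_UNIV_4[OF assms] by (metis UNIV_I empty_iff insert_iff)

lemma integer_lattice_add: "x \<in> integer_lattice \<Longrightarrow> y \<in> integer_lattice \<Longrightarrow> x + y \<in> integer_lattice"
  and integer_lattice_diff: "x \<in> integer_lattice \<Longrightarrow> y \<in> integer_lattice \<Longrightarrow> x - y \<in> integer_lattice"
  and integer_lattice_minus: "x \<in> integer_lattice \<Longrightarrow> - x \<in> integer_lattice"
  and integer_lattice_axis: "r \<in> \<int> \<Longrightarrow> axis k r \<in> integer_lattice"
  and integer_lattice_zero: "0 \<in> integer_lattice"
  by (auto simp: integer_lattice_def axis_def)

lemma omit_coord_eq: "omit_coord i x = x - (x $ i) *\<^sub>R axis i 1"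
  by (simp add: omit_coord_def vec_eq_iff axis_def)

lemma omit_coord_nth: "k \<noteq> i \<Longrightarrow> omit_coord i x $ k = x $ k"
  by (simp add: omit_coord_def)

lemma two_face_image:
  "two_face x i j = (\<lambda>(a, b). x + a *\<^sub>R axis i 1 + b *\<^sub>R axis j 1) ` ({0..1} \<times> {0..1})"
proof -
  have "{f a b | a b. 0 \<le> a \<and> a \<le> 1 \<and> 0 \<le> b \<and> b \<le> 1} = (\<lambda>(a, b). f a b) ` ({0..1} \<times> {0..1})"
    for f :: "real \<Rightarrow> real \<Rightarrow> real^4"
    by force
  then show ?thesis unfolding two_face_def .
qed

lemma two_face_translate: "two_face (x + y) a b = (+) x ` two_face y a b"
  unfolding two_face_image image_image by (simp add: case_prod_unfold add.assoc)

lemma two_face_commute: "two_face x a b = two_face x b a"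
  unfolding two_face_image by (subst product_swap[symmetric]) (simp add: image_image case_prod_unfold add_ac)

lemma two_faceI:
  "0 \<le> a \<Longrightarrow> a \<le> 1 \<Longrightarrow> 0 \<le> b \<Longrightarrow> b \<le> 1 \<Longrightarrow> x + a *\<^sub>R axis i 1 + b *\<^sub>R axis j 1 \<in> two_face x i j"
  unfolding two_face_def by blast

lemma interpolate_multiple:
  fixes n t u v :: real
  assumes "0 \<le> u" "u \<le> 1" "0 \<le> v" "v \<le> 1" "u * n \<le> t" "t \<le> v * n"
  shows "\<exists>\<theta>. 0 \<le> \<theta> \<and> \<theta> \<le> 1 \<and> \<theta> * n = t"
proof (cases "n = 0")
  case True
  then show ?thesis using assms by (intro exI[of _ 0]) auto
next
  case False
  have "0 \<le> t / n \<and> t / n \<le> 1"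
  proof (cases "n > 0")
    case True
    then have "0 \<le> u * n" "v * n \<le> n" using assms by auto
    then have "0 \<le> t" "t \<le> n" using assms by linarith+
    then show ?thesis using True by simp
  next
    case False
    then have "u * n \<ge> n" "v * n \<le> 0" using assms \<open>n \<noteq> 0\<close>
      by (auto simp: mult_nonneg_nonpos mult_le_cancel_right1)
    then have "n \<le> t" "t \<le> 0" using assms by linarith+
    then show ?thesis using False \<open>n \<noteq> 0\<close> by (simp add: divide_le_eq zero_le_divide_iff)
  qed
  then show ?thesis using False by (intro exI[of _ "t / n"]) simp
qed

text \<open>On the boundary of the unit square the form \<open>x * m + y * n\<close> takes every
  value that it takes on the square; the four disjuncts are the four sides.\<close>

lemma cover_multiples:
  fixes m n t :: real
  assumes "0 \<le> a" "a \<le> 1" "0 \<le> b" "b \<le> 1" "0 \<le> a'" "a' \<le> 1" "0 \<le> b'" "b' \<le> 1"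
    and "a' * m + b' * n \<le> t" "t \<le> a * m + b * n"
  shows "(\<exists>\<theta>. 0 \<le> \<theta> \<and> \<theta> \<le> 1 \<and> t = \<theta> * m) \<or> (\<exists>\<theta>. 0 \<le> \<theta> \<and> \<theta> \<le> 1 \<and> t = \<theta> * n) \<or>
    (\<exists>\<theta>. 0 \<le> \<theta> \<and> \<theta> \<le> 1 \<and> t = n + \<theta> * m) \<or> (\<exists>\<theta>. 0 \<le> \<theta> \<and> \<theta> \<le> 1 \<and> t = m + \<theta> * n)"
proof -
  have up: "t \<le> max m 0 + max n 0"
  proof -
    have "a * m \<le> max m 0" "b * n \<le> max n 0"
      using mult_right_mono[of a 1 m] mult_right_mono[of b 1 n] mult_nonneg_nonpos[of a m]
        mult_nonneg_nonpos[of b n] assms(1-8) by linarith+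
    then show ?thesis using assms by linarith
  qed
  have low: "min m 0 + min n 0 \<le> t"
  proof -
    have "min m 0 \<le> a' * m" "min n 0 \<le> b' * n"
      using mult_right_mono_neg[of a' 1 m] mult_right_mono_neg[of b' 1 n] mult_nonneg_nonneg[of a' m]
        mult_nonneg_nonneg[of b' n] assms(1-8) by linarith+
    then show ?thesis using assms by linarith
  qed
  have *: "\<exists>\<theta>. 0 \<le> \<theta> \<and> \<theta> \<le> 1 \<and> s = \<theta> * r" if "min r 0 \<le> s" "s \<le> max r 0" for r s :: real
    using interpolate_multiple[of 0 1 r s] interpolate_multiple[of 1 0 r s] that
    by (cases "r \<ge> 0") auto
  show ?thesis
  \<comment> \<open>With equal signs, the consecutive sides from \<open>0\<close> through
    \<open>n\<close> to \<open>m + n\<close> fill the range; with opposite signs, the two sides at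
    the origin do.\<close>
  proof (cases "m \<ge> 0 \<longleftrightarrow> n \<ge> 0")
    case True
    then have "(min n 0 \<le> t \<and> t \<le> max n 0) \<or> (min m 0 \<le> t - n \<and> t - n \<le> max m 0)"
      using up low by (auto simp: min_def max_def split: if_splits)
    then show ?thesis using *[of n t] *[of m "t - n"] by (metis diff_add_cancel add.commute)
  next
    case False
    then have "(min n 0 \<le> t \<and> t \<le> max n 0) \<or> (min m 0 \<le> t \<and> t \<le> max m 0)"
      using up low by (auto simp: min_def max_def split: if_splits)
    then show ?thesis using *[of n t] *[of m t] by metis
  qed
qed

section \<open>Shadow faces and periods of the shadow\<close>

text \<open>\<open>normal\<close> encodes that \<nu> is normal to the hyperplane
  \<open>E + span {axis i 1}\<close>, in the form in which it is used: points of the hyperplane can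
  be moved into \<open>E\<close> along \<open>axis i 1\<close>.\<close>

locale transversal_plane =
  fixes E :: "(real^4) set" and i :: 4 and \<nu> :: "real^4" and s :: "real^4"
  assumes normal: "\<And>v. \<nu> \<bullet> v = 0 \<longleftrightarrow> (\<exists>r. v + r *\<^sub>R axis i 1 \<in> E)"
    and normal_coord: "\<nu> $ i = 0"
begin

definition "F = (+) s ` E"
definition "h = \<nu> \<bullet> s"

lemma mem_F: "v \<in> F \<Longrightarrow> \<nu> \<bullet> v = h"
proof -
  assume "v \<in> F"
  then have "\<exists>r. (v - s) + r *\<^sub>R axis i 1 \<in> E"
    by (intro exI[of _ 0]) (auto simp: F_def)
  then have "\<nu> \<bullet> (v - s) = 0" using normal by blast
  then show ?thesis by (simp add: h_def inner_diff_right)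
qed

lemma obtain_F: 
  assumes "\<nu> \<bullet> v = h" obtains r where "v + r *\<^sub>R axis i 1 \<in> F"
proof -
  have "\<nu> \<bullet> (v - s) = 0" using assms by (simp add: h_def inner_diff_right)
  then obtain r where "v - s + r *\<^sub>R axis i 1 \<in> E" using normal by blast
  then have "v + r *\<^sub>R axis i 1 \<in> F"
    unfolding F_def by (rule rev_image_eqI) simp
  then show ?thesis by (rule that)
qed

lemma thickened_point:
  assumes "y \<in> {y + c | y c. y \<in> F \<and> c \<in> unit_cube}" "distinct [a, b, c, i]"
  obtains u where "u \<in> unit_cube"
    "h = \<nu> \<bullet> y - \<nu> $ a * u $ a - \<nu> $ b * u $ b - \<nu> $ c * u $ c"
proof -
  obtain z u where z: "y = z + u" "z \<in> F" "u \<in> unit_cube" using assms(1) by blast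
  have "h = \<nu> \<bullet> y - \<nu> \<bullet> u" using mem_F[OF z(2)] z(1) by (simp add: inner_add_right)
  then show ?thesis using that[OF z(3)] normal_coord inner_distinct_4[OF assms(2), of \<nu> u]
    by (simp add: algebra_simps)
qed

text \<open>The corner of the face where \<nu> is largest bounds \<open>h\<close> from below and the
  corner where it is smallest bounds \<open>h\<close> from above, each time by the value of \<nu> at
  a point between \<open>x - axis c 1\<close> and \<open>x\<close>. Interpolation gives
  \<theta>.\<close>

lemma selected_imp_shadow_face:
  assumes sub: "two_face x a b \<subseteq> {y + c | y c. y \<in> F \<and> c \<in> unit_cube}"
    and x: "x \<in> integer_lattice" and dist: "distinct [a, b, c, i]"
  shows "shadow_face \<nu> h i x a b c"
proof -
  have pt: "x + \<alpha> *\<^sub>R axis a 1 + \<beta> *\<^sub>R axis b 1 \<in> {y + c | y c. y \<in> F \<and> c \<in> unit_cube}"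
    if "\<alpha> \<in> {0, 1}" "\<beta> \<in> {0, 1}" for \<alpha> \<beta>
    by (rule subsetD[OF sub], rule two_faceI) (use that in auto)
  have *: "\<exists>u. u \<in> unit_cube \<and>
      h = \<nu> \<bullet> x + (\<alpha> - u $ a) * \<nu> $ a + (\<beta> - u $ b) * \<nu> $ b - u $ c * \<nu> $ c"
    if "\<alpha> \<in> {0, 1}" "\<beta> \<in> {0, 1}" for \<alpha> \<beta>
    by (rule thickened_point[OF pt[OF that] dist], rule exI, rule conjI, assumption)
      (simp add: inner_add_right inner_axis algebra_simps)
  obtain u where u: "u \<in> unit_cube" "h \<ge> \<nu> \<bullet> x - u $ c * \<nu> $ c"
  proof -
    let ?\<alpha> = "if \<nu> $ a \<ge> 0 then 1 else 0 :: real" and ?\<beta> = "if \<nu> $ b \<ge> 0 then 1 else 0 :: real"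
    obtain u where u: "u \<in> unit_cube"
      "h = \<nu> \<bullet> x + (?\<alpha> - u $ a) * \<nu> $ a + (?\<beta> - u $ b) * \<nu> $ b - u $ c * \<nu> $ c"
    proof -
      have "?\<alpha> \<in> {0, 1}" "?\<beta> \<in> {0, 1}" by auto
      from *[OF this] show ?thesis using that by blast
    qed
    have "(?\<alpha> - u $ a) * \<nu> $ a \<ge> 0" "(?\<beta> - u $ b) * \<nu> $ b \<ge> 0"
      using u(1) by (auto simp: unit_cube_def mult_nonneg_nonpos)
    then show ?thesis using that u by auto
  qed
  obtain u' where u': "u' \<in> unit_cube" "h \<le> \<nu> \<bullet> x - u' $ c * \<nu> $ c"
  proof -
    let ?\<alpha> = "if \<nu> $ a \<ge> 0 then 0 else 1 :: real" and ?\<beta> = "if \<nu> $ b \<ge> 0 then 0 else 1 :: real"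
    obtain u where u: "u \<in> unit_cube"
      "h = \<nu> \<bullet> x + (?\<alpha> - u $ a) * \<nu> $ a + (?\<beta> - u $ b) * \<nu> $ b - u $ c * \<nu> $ c"
    proof -
      have "?\<alpha> \<in> {0, 1}" "?\<beta> \<in> {0, 1}" by auto
      from *[OF this] show ?thesis using that by blast
    qed
    have "(?\<alpha> - u $ a) * \<nu> $ a \<le> 0" "(?\<beta> - u $ b) * \<nu> $ b \<le> 0"
      using u(1) by (auto simp: unit_cube_def mult_nonneg_nonpos)
    then show ?thesis using that u by auto
  qed
  have "\<exists>\<theta>. 0 \<le> \<theta> \<and> \<theta> \<le> 1 \<and> \<theta> * \<nu> $ c = \<nu> \<bullet> x - h"
    by (rule interpolate_multiple[of "u' $ c" "u $ c"]) (use u u' in \<open>auto simp: unit_cube_def\<close>)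
  then show ?thesis using x dist by (fastforce simp: shadow_face_def)
qed

text \<open>\<open>omit_coord i\<close> flattens a face containing direction \<open>i\<close> to an
  edge. Such a face adds nothing to the shadow, because one of the four squares around this edge
  belongs to the shadow anyway.\<close>

lemma selected_edge_imp_shadow_face:
  assumes sub: "two_face x i b \<subseteq> {y + c | y c. y \<in> F \<and> c \<in> unit_cube}"
    and x: "x \<in> integer_lattice" and "b \<noteq> i"
  obtains y a c where "shadow_face \<nu> h i y b a c"
    "omit_coord i ` two_face x i b \<subseteq> omit_coord i ` two_face y b a"
proof -
  obtain c d where dist: "distinct [b, c, d, i]" using obtain_distinct_4[OF \<open>b \<noteq> i\<close>] by blast
  have pt: "x + 0 *\<^sub>R axis i 1 + \<beta> *\<^sub>R axis b 1 \<in> {y + c | y c. y \<in> F \<and> c \<in> unit_cube}"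
    if "\<beta> \<in> {0, 1}" for \<beta>
    by (rule subsetD[OF sub], rule two_faceI) (use that in auto)
  have *: "\<exists>u. u \<in> unit_cube \<and>
      h = \<nu> \<bullet> x + (\<beta> - u $ b) * \<nu> $ b - u $ c * \<nu> $ c - u $ d * \<nu> $ d"
    if "\<beta> \<in> {0, 1}" for \<beta>
    by (rule thickened_point[OF pt[OF that] dist], rule exI, rule conjI, assumption)
      (simp add: inner_add_right inner_axis algebra_simps)
  obtain u where u: "u \<in> unit_cube" "\<nu> \<bullet> x - h \<le> u $ c * \<nu> $ c + u $ d * \<nu> $ d"
  proof -
    let ?\<beta> = "if \<nu> $ b \<ge> 0 then 1 else 0 :: real"
    obtain u where u: "u \<in> unit_cube"
      "h = \<nu> \<bullet> x + (?\<beta> - u $ b) * \<nu> $ b - u $ c * \<nu> $ c - u $ d * \<nu> $ d"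
    proof -
      have "?\<beta> \<in> {0, 1}" by auto
      from *[OF this] show ?thesis using that by blast
    qed
    have "(?\<beta> - u $ b) * \<nu> $ b \<ge> 0"
      using u(1) by (auto simp: unit_cube_def mult_nonneg_nonpos)
    then show ?thesis using that u by auto
  qed
  obtain u' where u': "u' \<in> unit_cube" "u' $ c * \<nu> $ c + u' $ d * \<nu> $ d \<le> \<nu> \<bullet> x - h"
  proof -
    let ?\<beta> = "if \<nu> $ b \<ge> 0 then 0 else 1 :: real"
    obtain u where u: "u \<in> unit_cube"
      "h = \<nu> \<bullet> x + (?\<beta> - u $ b) * \<nu> $ b - u $ c * \<nu> $ c - u $ d * \<nu> $ d"
    proof -
      have "?\<beta> \<in> {0, 1}" by auto
      from *[OF this] show ?thesis using that by blast
    qed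
    have "(?\<beta> - u $ b) * \<nu> $ b \<le> 0"
      using u(1) by (auto simp: unit_cube_def mult_nonneg_nonpos)
    then show ?thesis using that u by auto
  qed
  have edge: "omit_coord i ` two_face x i b \<subseteq> omit_coord i ` two_face x b a" for a
  proof -
    have "\<exists>z\<in>two_face x b a. omit_coord i (x + r *\<^sub>R axis i 1 + t *\<^sub>R axis b 1) = omit_coord i z"
      if "0 \<le> t" "t \<le> 1" for r t
      by (rule bexI[of _ "x + t *\<^sub>R axis b 1 + 0 *\<^sub>R axis a 1"])
        (use that in \<open>simp add: omit_coord_def vec_eq_iff axis_def\<close>,
          rule two_faceI, use that in auto)
    then show ?thesis by (auto simp: two_face_def[of x i b] image_iff)
  qed
  have edge': "omit_coord i ` two_face x i b \<subseteq> omit_coord i ` two_face (x - axis a 1) b a" for a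
  proof -
    have "\<exists>z\<in>two_face (x - axis a 1) b a. omit_coord i (x + r *\<^sub>R axis i 1 + t *\<^sub>R axis b 1) = omit_coord i z"
      if "0 \<le> t" "t \<le> 1" for r t
      by (rule bexI[of _ "x - axis a 1 + t *\<^sub>R axis b 1 + 1 *\<^sub>R axis a 1"])
        (use that in \<open>simp add: omit_coord_def vec_eq_iff axis_def\<close>,
          rule two_faceI, use that in auto)
    then show ?thesis by (auto simp: two_face_def[of x i b] image_iff)
  qed
  have xm: "x - axis a 1 \<in> integer_lattice" for a
    using x by (simp add: integer_lattice_diff integer_lattice_axis)
  \<comment> \<open>The side of the unit square found by \<open>cover_multiples\<close> decides
    which of \<open>c\<close>, \<open>d\<close> is the omitted direction and whether the square
    starts at \<open>x\<close> or one step before it.\<close>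
  consider (c) \<theta> where "0 \<le> \<theta>" "\<theta> \<le> 1" "\<nu> \<bullet> x - h = \<theta> * \<nu> $ c"
    | (d) \<theta> where "0 \<le> \<theta>" "\<theta> \<le> 1" "\<nu> \<bullet> x - h = \<theta> * \<nu> $ d"
    | (cd) \<theta> where "0 \<le> \<theta>" "\<theta> \<le> 1" "\<nu> \<bullet> x - h = \<nu> $ d + \<theta> * \<nu> $ c"
    | (dc) \<theta> where "0 \<le> \<theta>" "\<theta> \<le> 1" "\<nu> \<bullet> x - h = \<nu> $ c + \<theta> * \<nu> $ d"
    using cover_multiples[of "u $ c" "u $ d" "u' $ c" "u' $ d" "\<nu> $ c" "\<nu> $ d" "\<nu> \<bullet> x - h"] u u'
    unfolding unit_cube_def by blast
  then show ?thesis
  proof cases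
    case c
    then have "shadow_face \<nu> h i x b d c"
      using x dist by (auto simp: shadow_face_def intro!: exI[of _ \<theta>])
    then show ?thesis using that edge by blast
  next
    case d
    then have "shadow_face \<nu> h i x b c d"
      using x dist by (auto simp: shadow_face_def intro!: exI[of _ \<theta>])
    then show ?thesis using that edge by blast
  next
    case cd
    then have "shadow_face \<nu> h i (x - axis d 1) b d c"
      using xm dist by (auto simp: shadow_face_def inner_diff_right inner_axis intro!: exI[of _ \<theta>])
    then show ?thesis using that edge' by blast
  next
    case dc
    then have "shadow_face \<nu> h i (x - axis c 1) b c d"
      using xm dist by (auto simp: shadow_face_def inner_diff_right inner_axis intro!: exI[of _ \<theta>])
    then show ?thesis using that edge' by blast
  qed
qed

text \<open>A point between \<open>x - axis c 1\<close> and \<open>x\<close> on the hyperplane is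
  moved into \<open>F\<close> along \<open>axis i 1\<close>, and its height is rounded up to an
  integer. The rounding error \<open>r\<close>, \<theta> and the two face parameters are then the
  coordinates of a point of the unit cube.\<close>

lemma shadow_face_imp_selected:
  assumes "shadow_face \<nu> h i x a b c"
  obtains r where "two_face (x + r *\<^sub>R axis i 1) a b \<in> selected_faces F"
proof -
  obtain \<theta> where x: "x \<in> integer_lattice" and dist: "distinct [a, b, c, i]"
    and \<theta>: "0 \<le> \<theta>" "\<theta> \<le> 1" "\<nu> \<bullet> x - \<theta> * \<nu> $ c = h"
    using assms by (auto simp: shadow_face_def)
  have "\<nu> \<bullet> (x - \<theta> *\<^sub>R axis c 1) = h"
    using \<theta> by (simp add: inner_diff_right inner_axis)
  then obtain l where l: "x - \<theta> *\<^sub>R axis c 1 + l *\<^sub>R axis i 1 \<in> F" by (rule obtain_F)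
  define r where "r = of_int \<lceil>l\<rceil> - l"
  have r: "0 \<le> r" "r \<le> 1" unfolding r_def by linarith+
  have "two_face (x + of_int \<lceil>l\<rceil> *\<^sub>R axis i 1) a b \<subseteq> {y + c | y c. y \<in> F \<and> c \<in> unit_cube}"
  proof
    fix y assume "y \<in> two_face (x + of_int \<lceil>l\<rceil> *\<^sub>R axis i 1) a b"
    then obtain \<alpha> \<beta> where y: "y = x + of_int \<lceil>l\<rceil> *\<^sub>R axis i 1 + \<alpha> *\<^sub>R axis a 1 + \<beta> *\<^sub>R axis b 1"
      and ab: "0 \<le> \<alpha>" "\<alpha> \<le> 1" "0 \<le> \<beta>" "\<beta> \<le> 1" by (auto simp: two_face_def)
    let ?u = "\<theta> *\<^sub>R axis c 1 + r *\<^sub>R axis i 1 + \<alpha> *\<^sub>R axis a 1 + \<beta> *\<^sub>R axis b (1::real)"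
    have "?u \<in> unit_cube"
      unfolding unit_cube_def mem_Collect_eq all_distinct_4[OF dist]
      using dist ab r \<theta> by (auto simp: axis_def)
    moreover have "y = (x - \<theta> *\<^sub>R axis c 1 + l *\<^sub>R axis i 1) + ?u"
      by (simp add: y r_def algebra_simps)
    ultimately show "y \<in> {y + c | y c. y \<in> F \<and> c \<in> unit_cube}" using l by blast
  qed
  moreover have "x + of_int \<lceil>l\<rceil> *\<^sub>R axis i 1 \<in> integer_lattice"
    using x by (auto simp: integer_lattice_def axis_def)
  ultimately have "two_face (x + of_int \<lceil>l\<rceil> *\<^sub>R axis i 1) a b \<in> selected_faces F"
    using dist unfolding selected_faces_def mem_Collect_eq
    by (intro exI conjI) (rule refl, auto)
  then show ?thesis by (rule that)
qed

lemma omit_coord_two_face_shift: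
  "omit_coord i ` two_face (x + r *\<^sub>R axis i 1) a b = omit_coord i ` two_face x a b"
proof -
  have "omit_coord i (r *\<^sub>R axis i 1 + y) = omit_coord i y" for y
    by (simp add: omit_coord_def vec_eq_iff axis_def)
  then show ?thesis
    by (subst add.commute) (simp add: two_face_translate image_image)
qed

lemma shadow_eq:
  "shadow i F = \<Union>{omit_coord i ` two_face x a b | x a b. \<exists>c. shadow_face \<nu> h i x a b c}"
proof
  show "shadow i F \<subseteq> \<Union>{omit_coord i ` two_face x a b | x a b. \<exists>c. shadow_face \<nu> h i x a b c}"
  proof
    fix z assume "z \<in> shadow i F"
    then obtain x a b where x: "x \<in> integer_lattice" and "a \<noteq> b"
      and sub: "two_face x a b \<subseteq> {y + c | y c. y \<in> F \<and> c \<in> unit_cube}"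
      and z: "z \<in> omit_coord i ` two_face x a b"
      by (auto simp: shadow_def selected_faces_def)
    consider "a \<noteq> i" "b \<noteq> i" | "a = i" "b \<noteq> i" | "b = i" "a \<noteq> i" using \<open>a \<noteq> b\<close> by blast
    then show "z \<in> \<Union>{omit_coord i ` two_face x a b | x a b. \<exists>c. shadow_face \<nu> h i x a b c}"
    proof cases
      case 1
      then obtain c where "distinct [a, b, c, i]" using obtain_fourth \<open>a \<noteq> b\<close> by metis
      then show ?thesis using selected_imp_shadow_face[OF sub x] z by blast
    next
      case 2
      obtain y a' c where y: "shadow_face \<nu> h i y b a' c"
        "omit_coord i ` two_face x i b \<subseteq> omit_coord i ` two_face y b a'"
        by (rule selected_edge_imp_shadow_face[of x b]) (use sub x 2 in simp_all)
      have "z \<in> omit_coord i ` two_face y b a'" using y(2) z 2 by auto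
      then show ?thesis using y(1) by blast
    next
      case 3
      obtain y a' c where y: "shadow_face \<nu> h i y a a' c"
        "omit_coord i ` two_face x i a \<subseteq> omit_coord i ` two_face y a a'"
        by (rule selected_edge_imp_shadow_face[of x a]) (use sub x 3 in \<open>simp_all add: two_face_commute[of x i]\<close>)
      have "z \<in> omit_coord i ` two_face y a a'"
        using y(2) z 3 by (auto simp: two_face_commute[of x i])
      then show ?thesis using y(1) by blast
    qed
  qed
  show "\<Union>{omit_coord i ` two_face x a b | x a b. \<exists>c. shadow_face \<nu> h i x a b c} \<subseteq> shadow i F"
  proof
    fix z assume "z \<in> \<Union>{omit_coord i ` two_face x a b | x a b. \<exists>c. shadow_face \<nu> h i x a b c}"
    then obtain x a b c where *: "shadow_face \<nu> h i x a b c" "z \<in> omit_coord i ` two_face x a b" by blast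
    then obtain r where "two_face (x + r *\<^sub>R axis i 1) a b \<in> selected_faces F"
      using shadow_face_imp_selected by blast
    moreover have "z \<in> omit_coord i ` two_face (x + r *\<^sub>R axis i 1) a b"
      using * by (simp add: omit_coord_two_face_shift)
    ultimately show "z \<in> shadow i F" unfolding shadow_def by blast
  qed
qed

lemma shadow_translate_subset:
  assumes "q \<in> integer_lattice" "\<nu> \<bullet> q = 0" "q $ i = 0"
  shows "(+) q ` shadow i F \<subseteq> shadow i F"
proof -
  have omit: "omit_coord i (q + z) = q + omit_coord i z" for z
    using assms(3) by (simp add: omit_coord_def vec_eq_iff)
  have "(+) q ` omit_coord i ` two_face x a b \<subseteq> shadow i F" if "shadow_face \<nu> h i x a b c" for x a b c
  proof -
    have "shadow_face \<nu> h i (q + x) a b c"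
      using that assms by (auto simp: shadow_face_def integer_lattice_add inner_add_right)
    moreover have "(+) q ` omit_coord i ` two_face x a b = omit_coord i ` two_face (q + x) a b"
      by (simp add: two_face_translate image_image omit)
    ultimately show ?thesis unfolding shadow_eq by blast
  qed
  then show ?thesis by (subst shadow_eq) blast
qed

lemma shadow_translate_eq:
  assumes "q \<in> integer_lattice" "\<nu> \<bullet> q = 0" "q $ i = 0"
  shows "(+) q ` shadow i F = shadow i F"
proof
  show "(+) q ` shadow i F \<subseteq> shadow i F" by (rule shadow_translate_subset[OF assms])
  have *: "(+) (- q) ` shadow i F \<subseteq> shadow i F"
    by (rule shadow_translate_subset) (use assms in \<open>auto simp: integer_lattice_minus\<close>)
  show "shadow i F \<subseteq> (+) q ` shadow i F"
  proof
    fix z assume "z \<in> shadow i F"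
    then have "- q + z \<in> shadow i F" using * by blast
    then show "z \<in> (+) q ` shadow i F" by (rule rev_image_eqI) simp
  qed
qed

end

text \<open>As \<open>axis i 1\<close> is not in \<open>E\<close>, it spans a hyperplane together
  with \<open>E\<close>, and \<open>omit_coord i p\<close> is orthogonal to its normal; shadow faces
  depend on their base point only through the inner product with this normal. This is what certifies
  the subperiods of deformed planes.\<close>

lemma subperiodI:
  fixes E :: "(real^4) set"
  assumes E: "two_plane E" and axis: "axis i 1 \<notin> E" and p: "p \<in> E"
    and int: "omit_coord i p \<in> integer_lattice"
    and gcd: "Gcd (range (\<lambda>k. \<lfloor>omit_coord i p $ k\<rfloor>)) = 1"
  shows "subperiod E i p"
proof -
  have sub: "subspace E" and dim: "dim E = 2" using E by (auto simp: two_plane_def)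
  let ?H = "span (insert (axis i 1) E)"
  have dimH: "dim ?H = 3"
    using axis dim sub by (simp add: dim_insert span_eq_iff[THEN iffD2])
  obtain \<nu> where \<nu>: "\<nu> \<noteq> 0" "span ?H \<subseteq> {x. \<nu> \<bullet> x = 0}"
    using lowdim_subset_hyperplane[of ?H] dimH by auto
  have "?H = {x. \<nu> \<bullet> x = 0}"
  proof (rule subspace_dim_equal)
    show "dim {x. \<nu> \<bullet> x = 0} \<le> dim ?H"
      using dim_hyperplane[OF \<nu>(1)] dimH by simp
    show "?H \<subseteq> {x. \<nu> \<bullet> x = 0}" using \<nu>(2) by (simp add: span_span)
  qed (auto simp: subspace_hyperplane)
  then have normal: "\<nu> \<bullet> v = 0 \<longleftrightarrow> (\<exists>r. v + r *\<^sub>R axis i 1 \<in> E)" for v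
  proof -
    have "\<nu> \<bullet> v = 0 \<longleftrightarrow> v \<in> ?H" using \<open>?H = _\<close> by blast
    also have "\<dots> \<longleftrightarrow> (\<exists>r. v - r *\<^sub>R axis i 1 \<in> E)"
      using sub by (simp add: span_insert span_eq_iff[THEN iffD2])
    also have "\<dots> \<longleftrightarrow> (\<exists>r. v + r *\<^sub>R axis i 1 \<in> E)"
      by (metis diff_minus_eq_add scaleR_minus_left add_uminus_conv_diff)
    finally show ?thesis .
  qed
  have "axis i 1 \<in> ?H" by (simp add: span_base)
  then have \<nu>i: "\<nu> $ i = 0" using \<open>?H = _\<close> by (auto simp: inner_axis)
  have "\<nu> \<bullet> p = 0" unfolding normal using p by (intro exI[of _ 0]) simp
  then have "\<nu> \<bullet> omit_coord i p = 0"
    by (simp add: omit_coord_eq inner_diff_right inner_axis \<nu>i)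
  then have "(+) (omit_coord i p) ` shadow i ((+) s ` E) = shadow i ((+) s ` E)" for s
  proof -
    interpret transversal_plane E i \<nu> s by unfold_locales (use normal \<nu>i in auto)
    show ?thesis using shadow_translate_eq[OF int \<open>\<nu> \<bullet> omit_coord i p = 0\<close>]
      by (simp add: F_def omit_coord_def)
  qed
  then show ?thesis using p int gcd by (simp add: subperiod_def prime_period_def)
qed

section \<open>Deformations of the slope\<close>

definition cross2 :: "real^2 \<Rightarrow> real^2 \<Rightarrow> real" where
  "cross2 u v = u $ 1 * v $ 2 - u $ 2 * v $ 1"

lemma cross2_simps [simp]:
  "cross2 (u + u') v = cross2 u v + cross2 u' v" "cross2 u (v + v') = cross2 u v + cross2 u v'"
  "cross2 (u - u') v = cross2 u v - cross2 u' v" "cross2 u (v - v') = cross2 u v - cross2 u v'"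
  "cross2 (r *\<^sub>R u) v = r * cross2 u v" "cross2 u (r *\<^sub>R v) = r * cross2 u v"
  "cross2 u u = 0" "cross2 0 v = 0" "cross2 u 0 = 0"
  by (auto simp: cross2_def algebra_simps)

lemma cross2_commute: "cross2 v u = - cross2 u v"
  by (simp add: cross2_def)

lemma cramer2:
  assumes "cross2 u v \<noteq> 0"
  shows "x = (cross2 x v / cross2 u v) *\<^sub>R u + (cross2 u x / cross2 u v) *\<^sub>R v"
proof -
  have "cross2 u v * x $ j = cross2 x v * u $ j + cross2 u x * v $ j" if "j = 1 \<or> j = 2" for j
    using that by (auto simp: cross2_def algebra_simps)
  then have "x $ j = cross2 x v / cross2 u v * u $ j + cross2 u x / cross2 u v * v $ j"
    if "j = 1 \<or> j = 2" for j
    using that assms by (simp add: field_simps)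
  then show ?thesis by (simp add: vec_eq_iff forall_2)
qed

lemma cross2_eq_0D:
  assumes "cross2 u v = 0" "u \<noteq> 0"
  obtains c where "v = c *\<^sub>R u"
proof -
  have "u $ 1 \<noteq> 0 \<or> u $ 2 \<noteq> 0" using assms(2) by (auto simp: vec_eq_iff forall_2)
  then consider "u $ 1 \<noteq> 0" | "u $ 2 \<noteq> 0" by blast
  then show ?thesis
  proof cases
    case 1
    then have "v = (v $ 1 / u $ 1) *\<^sub>R u"
      using assms(1) by (auto simp: vec_eq_iff forall_2 cross2_def field_simps)
    then show ?thesis by (rule that)
  next
    case 2
    then have "v = (v $ 2 / u $ 2) *\<^sub>R u"
      using assms(1) by (auto simp: vec_eq_iff forall_2 cross2_def field_simps)
    then show ?thesis by (rule that)
  qed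
qed

lemma collinear_iff_cross2: "collinear {0, u, v} \<longleftrightarrow> cross2 u v = 0"
proof
  assume "cross2 u v = 0"
  then show "collinear {0, u, v}"
    unfolding collinear_lemma using cross2_eq_0D[of u v] by metis
next
  assume "collinear {0, u, v}"
  then show "cross2 u v = 0"
    unfolding collinear_lemma by auto
qed

section \<open>Rational-linear functionals and denominators\<close>

text \<open>\<open>1\<close> and an irrational \<open>x\<close> are independent over
  \<open>rat\<close>, so values prescribed on them extend to a linear map of the reals as a vector
  space over \<open>rat\<close>.\<close>

lemma rational_functional:
  fixes x :: real
  assumes "x \<notin> \<rat>"
  obtains f :: "real \<Rightarrow> real" where "\<And>a b. f (a + b) = f a + f b"
    "\<And>q y. q \<in> \<rat> \<Longrightarrow> f (q * y) = q * f y" "f 1 = 0" "f x = 1"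
proof -
  interpret Q: vector_space "\<lambda>(q::rat) (y::real). of_rat q * y"
    by unfold_locales (auto simp: algebra_simps of_rat_add of_rat_mult)
  interpret QQ: vector_space_pair "\<lambda>(q::rat) (y::real). of_rat q * y" "\<lambda>(q::rat) (y::real). of_rat q * y" ..
  have x1: "x \<noteq> 1" using assms by auto
  have "Q.independent {1, x}"
  proof -
    have "Q.independent {1}" by simp
    moreover have "x \<notin> Q.span {1}"
    proof
      assume "x \<in> Q.span {1}"
      then obtain q where "x = of_rat q" by (auto simp: Q.span_singleton)
      then show False using assms by auto
    qed
    ultimately have "Q.independent (insert x {1})" by (rule Q.independent_insertI[rotated])
    then show ?thesis by (simp add: insert_commute)
  qed
  then obtain f where f: "Vector_Spaces.linear (\<lambda>(q::rat) (y::real). of_rat q * y) (\<lambda>(q::rat) (y::real). of_rat q * y) f"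
    "\<forall>y\<in>{1, x}. f y = (if y = 1 then 0 else 1)"
    using QQ.linear_independent_extend[of "{1, x}" "\<lambda>y. if y = 1 then 0 else 1"] by auto
  interpret f: Vector_Spaces.linear "\<lambda>(q::rat) (y::real). of_rat q * y" "\<lambda>(q::rat) (y::real). of_rat q * y" f
    by (rule f(1))
  show ?thesis
  proof (rule that[of f])
    show "f (a + b) = f a + f b" for a b by (rule f.add)
    show "f (q * y) = q * f y" if "q \<in> \<rat>" for q y
      using that f.scale by (auto elim!: Rats_cases)
  qed (use f(2) x1 in auto)
qed

lemma axis_expansion: "(\<Sum>l\<in>UNIV. b $ l *\<^sub>R axis l (1::real)) = (b :: real^4)"
  using basis_expansion[of b] by (simp add: scalar_mult_eq_scaleR)

lemma rational_multiple_integral: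
  fixes v :: "real^4"
  assumes "\<And>l. v $ l \<in> \<rat>"
  obtains N :: real where "N \<noteq> 0" "N *\<^sub>R v \<in> integer_lattice"
proof -
  have "\<exists>n::nat. n \<noteq> 0 \<and> real n * v $ l \<in> \<int>" for l
  proof -
    obtain a :: int and b :: nat where "b \<noteq> 0" "v $ l = of_int a / of_nat b"
      using assms[of l] by (auto simp: Rats_eq_int_div_nat)
    then show ?thesis by (intro exI[of _ b]) auto
  qed
  then obtain n :: "4 \<Rightarrow> nat" where n: "\<And>l. n l \<noteq> 0" "\<And>l. real (n l) * v $ l \<in> \<int>" by metis
  have "(\<Prod>l\<in>UNIV. real (n l)) * v $ m \<in> \<int>" for m
  proof -
    have "(\<Prod>l\<in>UNIV. real (n l)) = real (n m) * (\<Prod>l\<in>UNIV - {m}. real (n l))"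
      by (simp add: prod.remove)
    then have "(\<Prod>l\<in>UNIV. real (n l)) * v $ m = real (\<Prod>l\<in>UNIV - {m}. n l) * (real (n m) * v $ m)"
      by simp
    also have "\<dots> \<in> \<int>" by (rule Ints_mult[OF Ints_of_nat n(2)])
    finally show ?thesis .
  qed
  then show ?thesis using n(1)
    by (intro that[of "\<Prod>l\<in>UNIV. real (n l)"]) (auto simp: integer_lattice_def)
qed

section \<open>The slope, the kernel of the projection and deformations\<close>

text \<open>\<open>\<kappa> i\<close> is the factor hidden in the collinearity of a fine projection,
  and \<open>inj\<close> makes \<pi> an isomorphism from \<open>E\<close> onto the plane.\<close>

locale fine_slope =
  fixes E :: "(real^4) set" and p :: "4 \<Rightarrow> real^4" and \<pi> :: "real^4 \<Rightarrow> real^2" and \<kappa> :: "4 \<Rightarrow> real"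
  assumes plane: "two_plane E"
    and irrational: "totally_irrational E"
    and finite_planes: "finite {E'. two_plane E' \<and>
       (\<exists>p'. \<forall>i. subperiod E' i (p' i) \<and> omit_coord i (p' i) = omit_coord i (p i))}"
    and linear_\<pi>: "linear \<pi>"
    and p_mem: "\<And>i. p i \<in> E"
    and p_int: "\<And>i. omit_coord i (p i) \<in> integer_lattice"
    and p_gcd: "\<And>i. Gcd (range (\<lambda>k. \<lfloor>omit_coord i (p i) $ k\<rfloor>)) = 1"
    and \<pi>_axis: "\<And>i. \<pi> (axis i 1) = \<kappa> i *\<^sub>R \<pi> (p i)"
    and \<kappa>_nz: "\<And>i. \<kappa> i \<noteq> 0"
    and d_cross: "\<And>i j. i \<noteq> j \<Longrightarrow> cross2 (\<pi> (p i)) (\<pi> (p j)) \<noteq> 0"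
    and inj: "\<And>v. v \<in> E \<Longrightarrow> \<pi> v = 0 \<Longrightarrow> v = 0"
begin

abbreviation d :: "4 \<Rightarrow> real^2" where "d i \<equiv> \<pi> (p i)"

definition k :: "4 \<Rightarrow> real^4" where "k i = p i - (1 / \<kappa> i) *\<^sub>R axis i 1"

lemmas \<pi>_simps = linear_add[OF linear_\<pi>] linear_diff[OF linear_\<pi>] linear_scale[OF linear_\<pi>] linear_0[OF linear_\<pi>]

lemma subspace_E: "subspace E" using plane by (simp add: two_plane_def)

lemma d_nz: "d i \<noteq> 0"
proof -
  obtain j where "j \<noteq> i" by (metis zero_neq_one)
  then show ?thesis using d_cross[of i j] by auto
qed

lemma omit_p_nz: "omit_coord i (p i) \<noteq> 0"
proof
  assume "omit_coord i (p i) = 0"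
  then show False using p_gcd[of i] by simp
qed

lemma \<pi>_k: "\<pi> (k i) = 0"
  by (simp add: k_def \<pi>_simps \<pi>_axis \<kappa>_nz)

lemma k_nth: "j \<noteq> i \<Longrightarrow> k i $ j = p i $ j"
  by (simp add: k_def axis_def)

lemma p_nth_int: "j \<noteq> i \<Longrightarrow> p i $ j \<in> \<int>"
  using p_int[of i] by (metis integer_lattice_def mem_Collect_eq omit_coord_nth)

lemma k_nth_int: "j \<noteq> i \<Longrightarrow> k i $ j \<in> \<int>"
  by (simp add: k_nth p_nth_int)

lemma ex_p_nth_nz: "\<exists>j. j \<noteq> i \<and> p i $ j \<noteq> 0"
  using omit_p_nz[of i] by (auto simp: omit_coord_def vec_eq_iff split: if_splits)

lemma k_nz: "k i \<noteq> 0"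
  using ex_p_nth_nz[of i] k_nth by (metis zero_index)

lemma \<pi>_axis_cross: "i \<noteq> j \<Longrightarrow> cross2 (\<pi> (axis i 1)) (\<pi> (axis j 1)) \<noteq> 0"
  by (simp add: \<pi>_axis \<kappa>_nz d_cross)

lemma \<pi>_scale_axis_eq_0: "\<pi> (r *\<^sub>R axis i 1) = 0 \<Longrightarrow> r = 0"
  by (simp add: \<pi>_simps \<pi>_axis \<kappa>_nz d_nz)

text \<open>Two such vectors differ by a multiple of \<open>axis i 1\<close>, and \<pi> kills no
  nonzero one. Identities in the kernel can thus be checked without coordinate \<open>i\<close>, the
  one where \<open>k i\<close> may fail to be an integer.\<close>

lemma ker_eq:
  assumes "\<pi> v = 0" "\<pi> w = 0" "\<And>j. j \<noteq> i \<Longrightarrow> v $ j = w $ j"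
  shows "v = w"
proof -
  have "v - w = (v $ i - w $ i) *\<^sub>R axis i 1"
    using assms(3) by (auto simp: vec_eq_iff axis_def)
  moreover have "\<pi> (v - w) = 0" by (simp add: \<pi>_simps assms)
  ultimately have "v $ i - w $ i = 0" using \<pi>_scale_axis_eq_0 by metis
  then have "v $ j = w $ j" for j using assms(3)[of j] by (cases "j = i") auto
  then show ?thesis by (simp add: vec_eq_iff)
qed

text \<open>The inverse of the restriction of \<pi> to \<open>E\<close>, written in the basis
  \<open>p 0\<close>, \<open>p 1\<close> by Cramer's rule.\<close>

definition \<sigma> :: "real^2 \<Rightarrow> real^4" where
  "\<sigma> v = (cross2 v (d 1) / cross2 (d 0) (d 1)) *\<^sub>R p 0 + (cross2 (d 0) v / cross2 (d 0) (d 1)) *\<^sub>R p 1"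

lemma linear_\<sigma>: "linear \<sigma>"
  by (rule linearI) (simp_all add: \<sigma>_def algebra_simps add_divide_distrib)

lemma \<sigma>_mem: "\<sigma> v \<in> E"
  unfolding \<sigma>_def by (intro subspace_add subspace_scale subspace_E p_mem)

lemma \<pi>_\<sigma>: "\<pi> (\<sigma> v) = v"
  unfolding \<sigma>_def using cramer2[OF d_cross[of 0 1], of v] by (simp add: \<pi>_simps)

lemma \<sigma>_\<pi>: "v \<in> E \<Longrightarrow> \<sigma> (\<pi> v) = v"
  using inj[of "\<sigma> (\<pi> v) - v"] by (simp add: \<pi>_simps \<pi>_\<sigma> subspace_diff[OF subspace_E] \<sigma>_mem)

lemma linear_eq_combination:
  assumes "linear g" "i \<noteq> j"
  shows "g v = (cross2 v (d j) / cross2 (d i) (d j)) *\<^sub>R g (d i) + (cross2 (d i) v / cross2 (d i) (d j)) *\<^sub>R g (d j)"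
  using arg_cong[where f = g, OF cramer2[OF d_cross[OF assms(2)], of v]]
  unfolding linear_add[OF assms(1)] linear_scale[OF assms(1)] .

lemma no_deformation:
  assumes g: "linear g" and gk: "\<And>i. \<exists>\<mu>. g (d i) = \<mu> *\<^sub>R k i"
  shows "g v = 0"
proof (rule ccontr)
  assume nz: "g v \<noteq> 0"
  obtain \<mu> where \<mu>: "\<And>i. g (d i) = \<mu> i *\<^sub>R k i" using gk by metis
  have ker: "\<pi> (g w) = 0" for w
    by (subst linear_eq_combination[OF g, of 0 1]) (simp_all add: \<mu> \<pi>_simps \<pi>_k)
  define f where "f s v = v + s *\<^sub>R g (\<pi> v)" for s v
  have lin: "linear (f s)" for s
    by (rule linearI) (simp_all add: f_def \<pi>_simps linear_add[OF g] linear_scale[OF g] algebra_simps)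
  have \<pi>f: "\<pi> (f s v) = \<pi> v" for s v
    by (simp add: f_def \<pi>_simps ker)
  have f_inj: "u = w" if "u \<in> E" "w \<in> E" "f s u = f t w" for s t u w
  proof -
    have "\<pi> (u - w) = 0" using \<pi>f that(3) by (metis \<pi>_simps(2) diff_self)
    then show ?thesis using inj[of "u - w"] that subspace_diff[OF subspace_E] by simp
  qed
  \<comment> \<open>For the finitely many excluded \<open>s\<close>, some \<open>f s (p i)\<close>
    is a multiple of \<open>axis i 1\<close> and cannot be rescaled to a subperiod.\<close>
  define S where "S = {s. \<forall>i. 1 + s * \<mu> i \<noteq> 0}"
  have "- S \<subseteq> (\<lambda>i. - 1 / \<mu> i) ` UNIV"
  proof
    fix s assume "s \<in> - S"
    then obtain i where i: "1 + s * \<mu> i = 0" by (auto simp: S_def)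
    then have "\<mu> i \<noteq> 0" by auto
    then have "s = - 1 / \<mu> i" using i by (simp add: field_simps)
    then show "s \<in> (\<lambda>i. - 1 / \<mu> i) ` UNIV" by blast
  qed
  then have "finite (- S)" by (rule finite_subset) simp
  then have infS: "infinite S"
    using infinite_UNIV_char_0[where 'a=real] by (metis Compl_partition finite_Un)
  have "inj_on (\<lambda>s. f s ` E) S"
  proof (rule inj_onI)
    fix s t assume "f s ` E = f t ` E"
    then obtain w where "w \<in> E" "f s (\<sigma> v) = f t w" using \<sigma>_mem by (metis imageE imageI)
    moreover from this have "\<sigma> v = w" using f_inj \<sigma>_mem by blast
    ultimately have "s *\<^sub>R g v = t *\<^sub>R g v" by (auto simp: f_def \<pi>_\<sigma>)
    then show "s = t" using nz by simp
  qed
  moreover have "(\<lambda>s. f s ` E) ` S \<subseteq> {E'. two_plane E' \<and>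
       (\<exists>p'. \<forall>i. subperiod E' i (p' i) \<and> omit_coord i (p' i) = omit_coord i (p i))}"
  proof clarify
    fix s assume s: "s \<in> S"
    have "inj_on (f s) (span E)"
      using f_inj by (auto simp: inj_on_def span_eq_iff[THEN iffD2, OF subspace_E])
    then have two: "two_plane (f s ` E)"
      using plane lin[of s] by (simp add: two_plane_def dim_image_eq linear_subspace_image)
    \<comment> \<open>This is \<open>f s (p i)\<close> divided by \<open>1 + s * \<mu> i\<close>,
      which restores the coordinates of \<open>p i\<close> off \<open>i\<close>.\<close>
    define p' where "p' i = p i - (s * \<mu> i / (\<kappa> i * (1 + s * \<mu> i))) *\<^sub>R axis i 1" for i
    have omit: "omit_coord i (p' i) = omit_coord i (p i)" for i
      by (simp add: p'_def omit_coord_def vec_eq_iff axis_def)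
    have nz': "1 + s * \<mu> i \<noteq> 0" for i using s by (simp add: S_def)
    have fp: "f s (p i) = (1 + s * \<mu> i) *\<^sub>R p i - (s * \<mu> i / \<kappa> i) *\<^sub>R axis i 1" for i
      by (simp add: f_def \<mu> k_def algebra_simps)
    have "f s ((1 / (1 + s * \<mu> i)) *\<^sub>R p i) = p' i" for i
      using nz'[of i] \<kappa>_nz[of i] unfolding linear_scale[OF lin] fp p'_def
      by (simp add: scaleR_diff_right mult.commute)
    then have p': "p' i \<in> f s ` E" for i
      using subspace_scale[OF subspace_E p_mem] by (metis imageI)
    \<comment> \<open>Applying \<pi> forces the preimage of \<open>axis i 1\<close> to be
      \<open>\<kappa> i *\<^sub>R p i\<close>, whose image under \<open>f s\<close> has a nonzero
      coordinate off \<open>i\<close>.\<close>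
    have axis: "axis i 1 \<notin> f s ` E" for i
    proof
      assume "axis i 1 \<in> f s ` E"
      then obtain w where w: "w \<in> E" "axis i 1 = f s w" by blast
      then have "\<pi> (w - \<kappa> i *\<^sub>R p i) = 0" using \<pi>f[of s w] \<pi>_axis[of i] by (simp add: \<pi>_simps)
      then have "w = \<kappa> i *\<^sub>R p i"
        using inj[of "w - \<kappa> i *\<^sub>R p i"] w(1) p_mem subspace_E by (simp add: subspace_diff subspace_scale)
      then have "axis i 1 = \<kappa> i *\<^sub>R ((1 + s * \<mu> i) *\<^sub>R p i - (s * \<mu> i / \<kappa> i) *\<^sub>R axis i 1)"
        using w(2) by (simp only: linear_scale[OF lin] fp)
      then have *: "axis i 1 $ j = (\<kappa> i *\<^sub>R ((1 + s * \<mu> i) *\<^sub>R p i - (s * \<mu> i / \<kappa> i) *\<^sub>R axis i 1)) $ j" for j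
        by (rule arg_cong)
      then have "axis i 1 $ j = \<kappa> i * (1 + s * \<mu> i) * p i $ j" if "j \<noteq> i" for j
        using that *[of j] by (simp add: axis_def)
      then have "p i $ j = 0" if "j \<noteq> i" for j
        using that nz'[of i] \<kappa>_nz[of i] by (auto simp: axis_def)
      then show False using ex_p_nth_nz by blast
    qed
    have "subperiod (f s ` E) i (p' i)" for i
      by (rule subperiodI[OF two axis p']) (use omit p_int p_gcd in simp_all)
    then show "two_plane (f s ` E) \<and>
      (\<exists>p'. \<forall>i. subperiod (f s ` E) i (p' i) \<and> omit_coord i (p' i) = omit_coord i (p i))"
      using two omit by blast
  qed
  ultimately have "finite S" using finite_planes by (meson finite_imageD finite_subset)
  then show False using infS by simp
qed

text \<open>The map \<open>cross2 (d i) x *\<^sub>R v\<close> kills \<open>d i\<close> and sends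
  every other \<open>d j\<close> to a multiple of \<open>k j\<close>, so it would be a nonzero
  deformation.\<close>

lemma k_not_all_collinear:
  assumes "v \<noteq> 0" and par: "\<And>j. j \<noteq> i \<Longrightarrow> \<exists>c. v = c *\<^sub>R k j"
  shows False
proof -
  let ?g = "\<lambda>x. cross2 (d i) x *\<^sub>R v"
  have lin: "linear ?g" by (rule linearI) (simp_all add: algebra_simps)
  have "\<exists>\<mu>. ?g (d j) = \<mu> *\<^sub>R k j" for j
  proof (cases "j = i")
    case True
    then show ?thesis by (intro exI[of _ 0]) simp
  next
    case False
    then obtain c where "v = c *\<^sub>R k j" using par by blast
    then show ?thesis by (intro exI[of _ "cross2 (d i) (d j) * c"]) simp
  qed
  then have "?g x = 0" for x by (rule no_deformation[OF lin])
  moreover obtain j where "j \<noteq> i" by (metis zero_neq_one)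
  ultimately show False using d_cross[of i j] assms(1) by auto
qed

text \<open>A vector supported on two positions is killed only if it is zero, since the projected
  axes are pairwise independent. Any two positions therefore serve as coordinates on the
  kernel.\<close>

lemma ker_coords:
  assumes "\<pi> b = 0" "b $ j = 0" "b $ l = 0" "j \<noteq> l"
  shows "b = 0"
proof -
  obtain i where "j \<noteq> i" "l \<noteq> i"
  proof -
    have "card {j, l} < card (UNIV :: 4 set)" using \<open>j \<noteq> l\<close> by simp
    then have "{j, l} \<noteq> UNIV" by (metis less_irrefl)
    then obtain i where "i \<notin> {j, l}" by blast
    then show ?thesis using that[of i] by auto
  qed
  then obtain c where dist: "distinct [j, l, c, i]" using obtain_fourth \<open>j \<noteq> l\<close> by metis
  have b: "b = b $ c *\<^sub>R axis c 1 + b $ i *\<^sub>R axis i 1"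
    unfolding vec_eq_iff all_distinct_4[OF dist] using dist assms by (auto simp: axis_def)
  have "\<pi> b = b $ c *\<^sub>R \<pi> (axis c 1) + b $ i *\<^sub>R \<pi> (axis i 1)"
    by (subst b) (simp only: \<pi>_simps)
  then have 0: "0 = b $ c *\<^sub>R \<pi> (axis c 1) + b $ i *\<^sub>R \<pi> (axis i 1)" using assms by simp
  have nz: "cross2 (\<pi> (axis c 1)) (\<pi> (axis i 1)) \<noteq> 0" using dist by (intro \<pi>_axis_cross) auto
  have "b $ c * cross2 (\<pi> (axis c 1)) (\<pi> (axis i 1)) = cross2 0 (\<pi> (axis i 1))"
    by (subst 0) simp
  moreover have "b $ i * cross2 (\<pi> (axis c 1)) (\<pi> (axis i 1)) = cross2 (\<pi> (axis c 1)) 0"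
    by (subst 0) simp
  ultimately show ?thesis using nz b by simp
qed

text \<open>Positions 0 and 1 map the kernel injectively into the plane, where Cramer's rule
  expresses \<open>t b\<close> by \<open>t (k x)\<close> and \<open>t (k y)\<close>.\<close>

lemma ker_span:
  assumes b: "\<pi> b = 0" and indep: "\<And>c. k x \<noteq> c *\<^sub>R k y"
  obtains \<alpha> \<beta> where "b = \<alpha> *\<^sub>R k x + \<beta> *\<^sub>R k y"
proof -
  define t :: "real^4 \<Rightarrow> real^2" where "t v = (\<chi> n. if n = 1 then v $ 0 else v $ 1)" for v
  have lin: "linear t" by (rule linearI) (auto simp: t_def vec_eq_iff)
  have t0: "v = 0" if "\<pi> v = 0" "t v = 0" for v
  proof (rule ker_coords[of v 0 1])
    show "v $ 0 = 0" "v $ 1 = 0" using that(2) by (auto simp: t_def vec_eq_iff forall_2)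
  qed (use that in auto)
  have nz: "cross2 (t (k x)) (t (k y)) \<noteq> 0"
  proof
    assume "cross2 (t (k x)) (t (k y)) = 0"
    moreover have "t (k x) \<noteq> 0" using t0[of "k x"] k_nz \<pi>_k by blast
    ultimately obtain c where "t (k y) = c *\<^sub>R t (k x)" using cross2_eq_0D by blast
    then have "k y - c *\<^sub>R k x = 0"
      by (intro t0) (simp_all add: \<pi>_simps \<pi>_k linear_diff[OF lin] linear_scale[OF lin])
    moreover from this have "c \<noteq> 0" using k_nz[of y] by auto
    ultimately have "k x = (1 / c) *\<^sub>R k y" by simp
    then show False using indep by blast
  qed
  let ?\<alpha> = "cross2 (t b) (t (k y)) / cross2 (t (k x)) (t (k y))"
  let ?\<beta> = "cross2 (t (k x)) (t b) / cross2 (t (k x)) (t (k y))"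
  have "b - (?\<alpha> *\<^sub>R k x + ?\<beta> *\<^sub>R k y) = 0"
  proof (rule t0)
    show "t (b - (?\<alpha> *\<^sub>R k x + ?\<beta> *\<^sub>R k y)) = 0"
      using cramer2[OF nz, of "t b"] by (simp only: linear_diff[OF lin] linear_add[OF lin] linear_scale[OF lin] right_minus_eq)
  qed (simp add: \<pi>_simps b \<pi>_k)
  then show ?thesis by (intro that[of ?\<alpha> ?\<beta>]) simp
qed

text \<open>The same sum with \<open>p l\<close> in place of \<open>k l\<close> lies in
  \<open>E\<close> and projects to \<open>\<pi> b = 0\<close>, so it vanishes; passing from
  \<open>p l\<close> to \<open>k l\<close> subtracts \<open>b\<close>. Read coordinatewise, this is
  a linear system for \<kappa>.\<close>

lemma ker_identity:
  assumes "\<pi> b = 0"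
  shows "(\<Sum>l\<in>UNIV. (b $ l * \<kappa> l) *\<^sub>R k l) = - b"
proof -
  have "\<pi> (\<Sum>l\<in>UNIV. (b $ l * \<kappa> l) *\<^sub>R p l) = (\<Sum>l\<in>UNIV. b $ l *\<^sub>R \<pi> (axis l 1))"
    by (simp add: linear_sum[OF linear_\<pi>] \<pi>_simps \<pi>_axis)
  also have "\<dots> = \<pi> (\<Sum>l\<in>UNIV. b $ l *\<^sub>R axis l 1)"
    by (simp add: linear_sum[OF linear_\<pi>] \<pi>_simps)
  also have "\<dots> = 0" using assms by (simp add: axis_expansion)
  finally have "(\<Sum>l\<in>UNIV. (b $ l * \<kappa> l) *\<^sub>R p l) = 0"
    by (intro inj subspace_sum subspace_scale subspace_E p_mem)
  moreover have "(b $ l * \<kappa> l) *\<^sub>R k l = (b $ l * \<kappa> l) *\<^sub>R p l - b $ l *\<^sub>R axis l 1" for l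
    by (simp add: k_def scaleR_diff_right \<kappa>_nz)
  ultimately show ?thesis by (simp add: sum_subtractf axis_expansion)
qed

text \<open>A linear system with rational coefficients determines \<open>\<kappa>\<close> up to deformations of the slope;
  applying a rational-linear functional to a solution gives a solution of the homogeneous system.\<close>

lemma rational_kernel_absurd:
  assumes rat: "\<And>u l. u \<noteq> i \<Longrightarrow> k u $ l \<in> \<rat>"
  shows False
proof -
  obtain j where j: "j \<noteq> i" by (metis zero_neq_one)
  obtain u where u: "u \<noteq> i" "\<And>c. k j \<noteq> c *\<^sub>R k u"
    using k_not_all_collinear[of "k j" i] k_nz by metis
  have "\<kappa> v \<in> \<rat>" for v
  proof (rule ccontr)
    assume "\<kappa> v \<notin> \<rat>"
    then obtain f :: "real \<Rightarrow> real" where f: "\<And>a b. f (a + b) = f a + f b"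
      "\<And>q y. q \<in> \<rat> \<Longrightarrow> f (q * y) = q * f y" "f 1 = 0" "f (\<kappa> v) = 1"
      by (rule rational_functional) blast
    have f_sum: "f (sum h A) = (\<Sum>l\<in>A. f (h l))" for h and A :: "4 set"
      by (rule additive.sum) (unfold_locales, rule f)
    \<comment> \<open>The left side of \<open>ker_identity\<close> with \<open>\<kappa> l\<close>
      replaced by \<open>f (\<kappa> l)\<close>.\<close>
    define G where "G b = (\<Sum>l\<in>UNIV. (b $ l * f (\<kappa> l)) *\<^sub>R k l)" for b :: "real^4"
    have lin: "linear G"
      by (rule linearI) (simp_all add: G_def algebra_simps sum.distrib scaleR_sum_right)
    have \<pi>G: "\<pi> (G b) = 0" for b
      by (simp add: G_def linear_sum[OF linear_\<pi>] \<pi>_simps \<pi>_k)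
    have G0: "G (k w) = 0" if w: "w \<noteq> i" for w
    proof (rule ker_eq[of _ _ i])
      fix r assume r: "r \<noteq> i"
      \<comment> \<open>For \<open>l = i\<close> only the integers \<open>k i $ r\<close> with
        \<open>r \<noteq> i\<close> occur: restricting to \<open>r \<noteq> i\<close> keeps the
        possibly irrational entry \<open>k i $ i\<close> out of the system.\<close>
      have q: "k w $ l * k l $ r \<in> \<rat>" for l
        using rat[OF w, of l] rat[of l r] k_nth_int[of r l] r Ints_subset_Rats by (cases "l = i") auto
      have "(\<Sum>l\<in>UNIV. (k w $ l * k l $ r) * \<kappa> l) = (\<Sum>l\<in>UNIV. (k w $ l * \<kappa> l) *\<^sub>R k l) $ r"
        by (simp add: mult_ac)
      also have "\<dots> = - k w $ r * 1"
        by (simp add: ker_identity[OF \<pi>_k])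
      finally have "f (\<Sum>l\<in>UNIV. (k w $ l * k l $ r) * \<kappa> l) = f (- k w $ r * 1)" by simp
      also have "\<dots> = 0" using f(2)[of "- k w $ r" 1] rat[OF w] f(3) by simp
      also have "f (\<Sum>l\<in>UNIV. (k w $ l * k l $ r) * \<kappa> l) = G (k w) $ r"
        unfolding f_sum f(2)[OF q] by (simp add: G_def mult_ac)
      finally show "G (k w) $ r = 0 $ r" by simp
    qed (simp_all add: \<pi>G \<pi>_simps)
    have G_ker: "G b = 0" if b: "\<pi> b = 0" for b
    proof -
      obtain \<alpha> \<beta> where "b = \<alpha> *\<^sub>R k j + \<beta> *\<^sub>R k u" using ker_span[OF b u(2)] by blast
      then show ?thesis
        by (simp add: linear_add[OF lin] linear_scale[OF lin] G0[OF j] G0[OF u(1)])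
    qed
    have G_axis: "G (axis l 1) = f (\<kappa> l) *\<^sub>R k l" for l
    proof -
      have "(axis l 1 $ m * f (\<kappa> m)) *\<^sub>R k m = (if m = l then f (\<kappa> l) *\<^sub>R k l else 0)" for m
        by (auto simp: axis_def)
      then show ?thesis by (simp add: G_def)
    qed
    have lin\<sigma>: "linear (\<lambda>x. G (\<sigma> x))" using linear_compose[OF linear_\<sigma> lin] by (simp add: o_def)
    \<comment> \<open>\<open>\<sigma> (d l)\<close> differs from \<open>axis l 1\<close> divided by
      \<open>\<kappa> l\<close> by a kernel vector, and \<open>G\<close> vanishes on the kernel.
      Hence \<open>G\<close> after \<sigma> is a deformation.\<close>
    have G\<sigma>: "G (\<sigma> (d l)) = (f (\<kappa> l) / \<kappa> l) *\<^sub>R k l" for l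
    proof -
      have "G (\<sigma> (d l) - (1 / \<kappa> l) *\<^sub>R axis l 1) = 0"
        by (rule G_ker) (simp add: \<pi>_simps \<pi>_\<sigma> \<pi>_axis \<kappa>_nz)
      then show ?thesis by (simp add: linear_diff[OF lin] linear_scale[OF lin] G_axis)
    qed
    have "G (\<sigma> x) = 0" for x by (rule no_deformation[OF lin\<sigma>]) (use G\<sigma> in blast)
    then have "f (\<kappa> v) / \<kappa> v = 0" using G\<sigma>[of v] k_nz[of v] by simp
    then show False using f(4) \<kappa>_nz[of v] by simp
  qed
  then have "p j $ l \<in> \<rat>" for l
    using rat[OF j, of l] by (cases "l = j") (auto simp: k_def axis_def dest: Rats_add[of _ "1 / \<kappa> j"])
  moreover have "p j \<noteq> 0" using ex_p_nth_nz[of j] by auto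
  ultimately show False using irrational p_mem[of j] by (auto simp: totally_irrational_def)
qed

section \<open>Lattice vectors under the projection\<close>

lemma cross2_\<pi>_expand:
  assumes "distinct [a, b, c, i]"
  shows "cross2 (d i) (\<pi> v) = cross2 (d i) (\<pi> (axis a 1)) * v $ a +
    cross2 (d i) (\<pi> (axis b 1)) * v $ b + cross2 (d i) (\<pi> (axis c 1)) * v $ c"
proof -
  have v: "v = v $ a *\<^sub>R axis a 1 + v $ b *\<^sub>R axis b 1 + v $ c *\<^sub>R axis c 1 + v $ i *\<^sub>R axis i 1"
    unfolding vec_eq_iff all_distinct_4[OF assms] using assms by (auto simp: axis_def)
  have "\<pi> v = v $ a *\<^sub>R \<pi> (axis a 1) + v $ b *\<^sub>R \<pi> (axis b 1) + v $ c *\<^sub>R \<pi> (axis c 1) + v $ i *\<^sub>R \<pi> (axis i 1)"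
    by (subst v) (simp only: \<pi>_simps)
  then show ?thesis by (simp add: \<pi>_axis[of i])
qed

text \<open>The three numbers \<open>cross2 (d i) (\<pi> (axis u 1))\<close> with
  \<open>u \<noteq> i\<close> satisfy one integer relation given by \<open>m\<close> and one given
  by \<open>p i\<close>. If these are independent, the numbers have rational ratios; the relation
  given by \<open>k u\<close> then makes its only non-integer coordinate rational, which
  \<open>rational_kernel_absurd\<close> excludes.\<close>

lemma lattice_parallel:
  assumes m: "m \<in> integer_lattice" and par: "cross2 (d i) (\<pi> m) = 0"
  obtains \<rho> s where "m = \<rho> *\<^sub>R p i + s *\<^sub>R axis i 1"
proof (rule ccontr)
  assume neg: "\<not> thesis"
  obtain j where j: "j \<noteq> i" "p i $ j \<noteq> 0" using ex_p_nth_nz by blast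
  define \<rho> where "\<rho> = m $ j / p i $ j"
  have "\<exists>l. l \<noteq> i \<and> m $ l \<noteq> \<rho> * p i $ l"
  proof (rule ccontr)
    assume "\<nexists>l. l \<noteq> i \<and> m $ l \<noteq> \<rho> * p i $ l"
    then have "m = \<rho> *\<^sub>R p i + (m $ i - \<rho> * p i $ i) *\<^sub>R axis i 1"
      by (auto simp: vec_eq_iff axis_def)
    then show False using neg that by blast
  qed
  then obtain l where l: "l \<noteq> i" "m $ l \<noteq> \<rho> * p i $ l" by blast
  \<comment> \<open>A minor of \<open>m\<close> and \<open>p i\<close>, nonzero because they are not
    proportional off \<open>i\<close>. Solving the two relations for the ratios divides by
    it.\<close>
  define D where "D = m $ l * p i $ j - m $ j * p i $ l"
  have D: "D \<noteq> 0" using l j by (simp add: D_def \<rho>_def field_simps)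
  then have "j \<noteq> l" by (auto simp: D_def)
  then obtain n where dist: "distinct [j, l, n, i]" using obtain_fourth j l by metis
  define a where "a u = cross2 (d i) (\<pi> (axis u 1))" for u
  have a_nz: "a u \<noteq> 0" if "u \<noteq> i" for u
    using d_cross[of i u] that by (simp add: a_def \<pi>_axis \<kappa>_nz)
  have rel: "a j * v $ j + a l * v $ l + a n * v $ n = 0" if "cross2 (d i) (\<pi> v) = 0" for v
    using that cross2_\<pi>_expand[OF dist, of v] by (simp add: a_def)
  have m_int: "m $ u \<in> \<int>" for u using m by (simp add: integer_lattice_def)
  have rm: "a j * m $ j + a l * m $ l + a n * m $ n = 0" by (rule rel[OF par])
  have rp: "a j * p i $ j + a l * p i $ l + a n * p i $ n = 0" by (rule rel) simp
  have "a l * D = - a n * (m $ n * p i $ j - m $ j * p i $ n)"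
    using rm rp unfolding D_def by algebra
  then have al: "a l / a n = - (m $ n * p i $ j - m $ j * p i $ n) / D"
    using D a_nz[of n] dist by (simp add: field_simps)
  have "a j * D = a n * (m $ n * p i $ l - m $ l * p i $ n)"
    using rm rp unfolding D_def by algebra
  then have aj: "a j / a n = (m $ n * p i $ l - m $ l * p i $ n) / D"
    using D a_nz[of n] dist by (simp add: field_simps)
  have "D \<in> \<int>" unfolding D_def using m_int p_nth_int j l by auto
  have ratl: "a l / a n \<in> \<rat>" and ratj: "a j / a n \<in> \<rat>"
  proof -
    have q: "m $ u * p i $ w - m $ u' * p i $ w' \<in> \<rat>" if "w \<noteq> i" "w' \<noteq> i" for u w u' w'
      using m_int p_nth_int that by (intro subsetD[OF Ints_subset_Rats] Ints_diff Ints_mult)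
    show "a l / a n \<in> \<rat>" "a j / a n \<in> \<rat>"
      unfolding al aj using \<open>D \<in> \<int>\<close> Ints_subset_Rats dist
      by (auto intro!: Rats_divide Rats_minus_iff[THEN iffD2] q simp del: minus_diff_eq)
  qed
  have "k u $ w \<in> \<rat>" if u: "u \<noteq> i" for u w
  proof (cases "w = u")
    case False
    then show ?thesis using k_nth_int Ints_subset_Rats by blast
  next
    case True
    have "a j * k u $ j + a l * k u $ l + a n * k u $ n = 0"
      by (rule rel) (simp add: \<pi>_k)
    then have "(a j * k u $ j + a l * k u $ l + a n * k u $ n) / a n = 0" by simp
    then have r: "(a j / a n) * k u $ j + (a l / a n) * k u $ l + k u $ n = 0"
      using a_nz[of n] dist by (simp add: add_divide_distrib)
    have ku: "k u $ x \<in> \<rat>" if "x \<noteq> u" for x using k_nth_int[OF that] Ints_subset_Rats by blast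
    have nz: "a j / a n \<noteq> 0" "a l / a n \<noteq> 0" using a_nz dist by auto
    have solve: "A = - (y * B + z) / x" if "x * A + y * B + z = 0" "x \<noteq> 0" for x y z A B :: real
    proof -
      have "x * A = - (y * B + z)" using that(1) by linarith
      then show ?thesis using that(2) by (simp add: nonzero_eq_divide_eq mult.commute)
    qed
    consider "u = j" | "u = l" | "u = n" using u distinct_UNIV_4[OF dist] by blast
    then have "k u $ u \<in> \<rat>"
    proof cases
      case 1
      have "k u $ j = - ((a l / a n) * k u $ l + k u $ n) / (a j / a n)"
        by (rule solve[OF r nz(1)])
      also have "\<dots> \<in> \<rat>" 
        by (intro Rats_divide[OF _ ratj] Rats_minus_iff[THEN iffD2] Rats_add Rats_mult[OF ratl] ku)
          (use 1 dist in auto)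
      finally show ?thesis using 1 by simp
    next
      case 2
      have "k u $ l = - ((a j / a n) * k u $ j + k u $ n) / (a l / a n)"
        by (rule solve[OF _ nz(2)]) (use r in linarith)
      also have "\<dots> \<in> \<rat>" 
        by (intro Rats_divide[OF _ ratl] Rats_minus_iff[THEN iffD2] Rats_add Rats_mult[OF ratj] ku)
          (use 2 dist in auto)
      finally show ?thesis using 2 by simp
    next
      case 3
      have "k u $ n = - ((a j / a n) * k u $ j + (a l / a n) * k u $ l)"
        using r by linarith
      also have "\<dots> \<in> \<rat>" 
        by (intro Rats_minus_iff[THEN iffD2] Rats_add Rats_mult[OF ratl] Rats_mult[OF ratj] ku)
          (use 3 dist in auto)
      finally show ?thesis using 3 by simp
    qed
    then show ?thesis using True by simp
  qed
  then show False by (rule rational_kernel_absurd)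
qed

text \<open>A lattice vector in the kernel is trivially projected to a multiple of every
  \<open>d i\<close>, which makes it a multiple of every \<open>k i\<close>.\<close>

lemma inj_lattice:
  assumes m: "m \<in> integer_lattice" and ker: "\<pi> m = 0"
  shows "m = 0"
proof (rule ccontr)
  assume "m \<noteq> 0"
  moreover have "\<exists>c. m = c *\<^sub>R k i" for i
  proof -
    obtain \<rho> s where ms: "m = \<rho> *\<^sub>R p i + s *\<^sub>R axis i 1"
      using lattice_parallel[OF m, of i] ker by auto
    have "m = \<rho> *\<^sub>R k i"
      by (rule ker_eq[of _ _ i]) (simp_all add: ker \<pi>_simps \<pi>_k k_nth, simp add: ms axis_def)
    then show ?thesis by blast
  qed
  ultimately show False using k_not_all_collinear[of m 0] by blast
qed

text \<open>If proportional \<open>k i\<close> and \<open>k j\<close> share a nonzero coordinate off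
  \<open>i\<close> and \<open>j\<close>, the factor is rational, so \<open>k j\<close> is rational
  and has a multiple that is a lattice vector in the kernel. Otherwise \<open>p i\<close> and
  \<open>p j\<close> span a coordinate plane and \<open>E\<close> contains
  \<open>axis i 1\<close>.\<close>

lemma k_independent:
  assumes "i \<noteq> j"
  shows "k i \<noteq> c *\<^sub>R k j"
proof
  assume c: "k i = c *\<^sub>R k j"
  then have "c \<noteq> 0" using k_nz[of i] by auto
  show False
  proof (cases "\<exists>l. l \<noteq> i \<and> l \<noteq> j \<and> k j $ l \<noteq> 0")
    case True
    then obtain l where l: "l \<noteq> i" "l \<noteq> j" "k j $ l \<noteq> 0" by blast
    then have "c = k i $ l / k j $ l" using c by simp
    then have "c \<in> \<rat>" using k_nth_int l Ints_subset_Rats by (metis Rats_divide subsetD)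
    have "k j $ j = k i $ j / c" using c \<open>c \<noteq> 0\<close> by simp
    then have "k j $ j \<in> \<rat>"
      using \<open>c \<in> \<rat>\<close> k_nth_int[of j i] assms Ints_subset_Rats by (metis Rats_divide subsetD)
    then have "k j $ m \<in> \<rat>" for m
      using k_nth_int[of m j] Ints_subset_Rats by (cases "m = j") auto
    then obtain N where N: "N \<noteq> 0" "N *\<^sub>R k j \<in> integer_lattice"
      using rational_multiple_integral by blast
    have "N *\<^sub>R k j = 0" by (rule inj_lattice[OF N(2)]) (simp add: \<pi>_simps \<pi>_k)
    then show False using N(1) k_nz by simp
  next
    case False
    then have 0: "p j $ l = 0" "p i $ l = 0" if "l \<noteq> i" "l \<noteq> j" for l
      using that c k_nth[of l j] k_nth[of l i] by auto
    have pi: "p i = p i $ i *\<^sub>R axis i 1 + p i $ j *\<^sub>R axis j 1"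
      using 0 assms by (auto simp: vec_eq_iff axis_def)
    have pj: "p j = p j $ i *\<^sub>R axis i 1 + p j $ j *\<^sub>R axis j 1"
      using 0 assms by (auto simp: vec_eq_iff axis_def)
    let ?D = "p i $ i * p j $ j - p i $ j * p j $ i"
    have "d i = p i $ i *\<^sub>R \<pi> (axis i 1) + p i $ j *\<^sub>R \<pi> (axis j 1)"
      by (subst pi) (simp only: \<pi>_simps)
    moreover have "d j = p j $ i *\<^sub>R \<pi> (axis i 1) + p j $ j *\<^sub>R \<pi> (axis j 1)"
      by (subst pj) (simp only: \<pi>_simps)
    ultimately have "cross2 (d i) (d j) = ?D * cross2 (\<pi> (axis i 1)) (\<pi> (axis j 1))"
      using cross2_commute[of "\<pi> (axis i 1)" "\<pi> (axis j 1)"] by (simp add: algebra_simps)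
    then have D: "?D \<noteq> 0" using d_cross[OF assms] by auto
    have "(p j $ j *\<^sub>R p i - p i $ j *\<^sub>R p j) $ l = (?D *\<^sub>R axis i 1) $ l" for l
      using 0[of l] assms by (cases "l = i"; cases "l = j") (auto simp: axis_def algebra_simps)
    then have "p j $ j *\<^sub>R p i - p i $ j *\<^sub>R p j = ?D *\<^sub>R axis i 1"
      unfolding vec_eq_iff by blast
    moreover have "p j $ j *\<^sub>R p i - p i $ j *\<^sub>R p j \<in> E"
      by (intro subspace_diff subspace_scale subspace_E p_mem)
    ultimately have "?D *\<^sub>R axis i 1 \<in> E" by simp
    then have "(1 / ?D) *\<^sub>R ?D *\<^sub>R axis i 1 \<in> E" by (rule subspace_scale[OF subspace_E])
    then have "axis i 1 \<in> E" using D by simp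
    moreover have "axis i (1::real) $ m \<in> \<rat>" for m by (auto simp: axis_def)
    moreover have "axis i (1::real) \<noteq> 0" by (simp add: axis_eq_0_iff)
    ultimately show False using irrational by (auto simp: totally_irrational_def)
  qed
qed

end

section \<open>Edge-to-edge tilings by parallelograms\<close>

text \<open>The sets with \<open>P\<close> and the sets without it have closed unions, disjoint
  because touching sets share \<open>P\<close>; a connected \<open>S\<close> cannot meet
  both.\<close>

lemma finite_closed_cover_connected:
  assumes fin: "finite \<F>" and closed: "\<And>A. A \<in> \<F> \<Longrightarrow> closed A"
    and S: "connected S" "S \<subseteq> \<Union>\<F>"
    and step: "\<And>A B. A \<in> \<F> \<Longrightarrow> B \<in> \<F> \<Longrightarrow> A \<inter> B \<noteq> {} \<Longrightarrow> P A \<Longrightarrow> P B"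
    and A: "A \<in> \<F>" "A \<inter> S \<noteq> {}" "P A" and B: "B \<in> \<F>" "B \<inter> S \<noteq> {}"
  shows "P B"
proof (rule ccontr)
  assume "\<not> P B"
  let ?U = "\<Union>{A \<in> \<F>. P A}" and ?V = "\<Union>{A \<in> \<F>. \<not> P A}"
  have "closed ?U" "closed ?V" using fin closed by auto
  moreover have "S \<subseteq> ?U \<union> ?V" using S(2) by blast
  moreover have "?U \<inter> ?V = {}" using step by blast
  moreover have "?U \<inter> S \<noteq> {}" using A by blast
  moreover have "?V \<inter> S \<noteq> {}" using B \<open>\<not> P B\<close> by blast
  ultimately show False using connected_closedD[OF S(1), of ?U ?V] by blast
qed

text \<open>An empty band of distances between \<open>n * c\<close> and \<open>Suc n * c\<close>
  would confine the chain to distance \<open>n * c\<close>. If the bound failed, all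
  \<open>card \<F> + 1\<close> bands would be occupied, by pairwise different sets.\<close>

lemma finite_closed_cover_chain:
  fixes F :: "'a::topological_space set \<Rightarrow> 'b::metric_space" and c :: real
  assumes fin: "finite \<F>" and closed: "\<And>A. A \<in> \<F> \<Longrightarrow> closed A"
    and S: "connected S" "S \<subseteq> \<Union>\<F>"
    and step: "\<And>A B. A \<in> \<F> \<Longrightarrow> B \<in> \<F> \<Longrightarrow> A \<inter> B \<noteq> {} \<Longrightarrow> dist (F A) (F B) \<le> c"
    and A: "A \<in> \<F>" "A \<inter> S \<noteq> {}" and B: "B \<in> \<F>" "B \<inter> S \<noteq> {}"
  shows "dist (F A) (F B) \<le> real (card \<F>) * c"
proof (rule ccontr)
  assume neg: "\<not> ?thesis"
  have "A \<noteq> {}" using A by blast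
  then have "c \<ge> 0" using step[OF A(1) A(1)] by simp
  have ex: "\<exists>C\<in>\<F>. real n * c < dist (F A) (F C) \<and> dist (F A) (F C) \<le> real (Suc n) * c"
    if n: "n \<le> card \<F>" for n
  proof (rule ccontr)
    assume none: "\<not> ?thesis"
    have "dist (F A) (F B) \<le> real n * c"
    proof (rule finite_closed_cover_connected[OF fin closed S, where P = "\<lambda>C. dist (F A) (F C) \<le> real n * c"])
      fix C D assume CD: "C \<in> \<F>" "D \<in> \<F>" "C \<inter> D \<noteq> {}" "dist (F A) (F C) \<le> real n * c"
      have "dist (F A) (F D) \<le> dist (F A) (F C) + dist (F C) (F D)" by (rule dist_triangle)
      also have "\<dots> \<le> real (Suc n) * c" using CD(4) step[OF CD(1-3)] by (simp add: algebra_simps)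
      finally show "dist (F A) (F D) \<le> real n * c" using none CD(2) by force
    qed (use A B \<open>c \<ge> 0\<close> in auto)
    also have "\<dots> \<le> real (card \<F>) * c" using n \<open>c \<ge> 0\<close> by (intro mult_right_mono) auto
    finally show False using neg by simp
  qed
  then obtain C where C: "\<And>n. n \<le> card \<F> \<Longrightarrow> C n \<in> \<F>"
    "\<And>n. n \<le> card \<F> \<Longrightarrow> real n * c < dist (F A) (F (C n))"
    "\<And>n. n \<le> card \<F> \<Longrightarrow> dist (F A) (F (C n)) \<le> real (Suc n) * c" by metis
  have "inj_on C {..card \<F>}"
  proof (rule linorder_inj_onI')
    fix m n assume "m \<in> {..card \<F>}" "n \<in> {..card \<F>}" "m < n"
    then have "dist (F A) (F (C m)) \<le> real (Suc m) * c" "real n * c < dist (F A) (F (C n))"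
      using C by auto
    moreover have "real (Suc m) * c \<le> real n * c"
      using \<open>m < n\<close> \<open>c \<ge> 0\<close> by (intro mult_right_mono) auto
    ultimately show "C m \<noteq> C n" by auto
  qed
  then have "card {..card \<F>} \<le> card \<F>" using C(1) fin by (intro card_inj_on_le[of C]) auto
  then show False by simp
qed

text \<open>Each ball of radius \<open>r / 2\<close> in a finite cover of \<open>cball 0 R\<close>
  contains at most one translated point; translating first makes the count independent of
  \<open>z\<close>.\<close>

lemma separated_card_bound:
  fixes r R :: real
  assumes "r > 0"
  obtains N :: nat where "\<And>(z :: 'a::euclidean_space) S. S \<subseteq> cball z R \<Longrightarrow>
    (\<And>x y. x \<in> S \<Longrightarrow> y \<in> S \<Longrightarrow> x \<noteq> y \<Longrightarrow> r \<le> dist x y) \<Longrightarrow> finite S \<and> card S \<le> N"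
proof -
  obtain K :: "'a set" where K: "finite K" "cball 0 R \<subseteq> (\<Union>x\<in>K. ball x (r / 2))"
    using compact_eq_totally_bounded[of "cball (0::'a) R"] \<open>r > 0\<close> by (meson compact_cball half_gt_zero)
  have "finite S \<and> card S \<le> card K"
    if S: "S \<subseteq> cball z R" and sep: "\<And>x y. x \<in> S \<Longrightarrow> y \<in> S \<Longrightarrow> x \<noteq> y \<Longrightarrow> r \<le> dist x y" for z :: 'a and S
  proof -
    have "\<exists>k\<in>K. x - z \<in> ball k (r / 2)" if "x \<in> S" for x
    proof -
      have "x - z \<in> cball 0 R" using S that by (auto simp: dist_norm norm_minus_commute)
      then show ?thesis using K(2) by blast
    qed
    then obtain f where f: "\<And>x. x \<in> S \<Longrightarrow> f x \<in> K" "\<And>x. x \<in> S \<Longrightarrow> x - z \<in> ball (f x) (r / 2)" by metis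
    have inj: "inj_on f S"
    proof (rule inj_onI, rule ccontr)
      fix x y assume xy: "x \<in> S" "y \<in> S" "f x = f y" "x \<noteq> y"
      have "dist (f x) (x - z) < r / 2" using f(2)[OF xy(1)] by simp
      moreover have "dist (f x) (y - z) < r / 2" using f(2)[OF xy(2)] xy(3) by simp
      ultimately have "dist (x - z) (y - z) < r" by (rule dist_triangle_half_r)
      then show False using sep[OF xy(1,2,4)] by (simp add: dist_norm)
    qed
    have "f ` S \<subseteq> K" using f(1) by blast
    then show ?thesis using inj K(1) by (meson card_inj_on_le inj_on_finite)
  qed
  then show ?thesis by (rule that)
qed

section \<open>Faces, counting and chains of tiles\<close>

locale parallelogram_tiling =
  fixes \<pi> :: "real^4 \<Rightarrow> real^2" and \<A> :: "(real^2) set set"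
  assumes lin: "linear \<pi>"
    and cross_axis: "\<And>i j. i \<noteq> j \<Longrightarrow> cross2 (\<pi> (axis i 1)) (\<pi> (axis j 1)) \<noteq> 0"
    and tiling: "plane_tiling \<A>"
    and tiles: "\<And>A. A \<in> \<A> \<Longrightarrow> \<exists>\<tau> i j. i \<noteq> j \<and> A = (+) \<tau> ` \<pi> ` two_face 0 i j"
begin

definition parallelogram :: "4 \<Rightarrow> 4 \<Rightarrow> real \<times> real \<Rightarrow> real^2" where
  "parallelogram i j x = fst x *\<^sub>R \<pi> (axis i 1) + snd x *\<^sub>R \<pi> (axis j 1)"

lemma linear_parallelogram: "linear (parallelogram i j)"
  by (rule linearI) (simp_all add: parallelogram_def algebra_simps)

lemma image_two_face: "\<pi> ` two_face 0 i j = parallelogram i j ` ({0..1} \<times> {0..1})"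
  unfolding two_face_image image_image
  by (simp add: case_prod_unfold parallelogram_def linear_add[OF lin] linear_scale[OF lin])

lemma tileE:
  assumes "A \<in> \<A>"
  obtains \<tau> i j where "i \<noteq> j" "A = (+) \<tau> ` parallelogram i j ` ({0..1} \<times> {0..1})"
  using tiles[OF assms] by (auto simp: image_two_face)

lemma tile_compact: "A \<in> \<A> \<Longrightarrow> compact A"
  by (erule tileE) (auto intro!: compact_translation compact_continuous_image linear_continuous_on
    compact_Times linear_parallelogram simp: linear_conv_bounded_linear[symmetric])

lemma tile_closed: "A \<in> \<A> \<Longrightarrow> closed A"
  by (simp add: tile_compact compact_imp_closed)

lemma tile_convex: "A \<in> \<A> \<Longrightarrow> convex A"
  by (erule tileE) (auto intro!: convex_translation convex_linear_image convex_Times linear_parallelogram)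

lemma tile_nonempty: "A \<in> \<A> \<Longrightarrow> A \<noteq> {}"
  by (erule tileE) auto

lemma cover: "\<exists>A\<in>\<A>. z \<in> A"
  using tiling by (auto simp: plane_tiling_def)

lemma extreme_exists: "A \<in> \<A> \<Longrightarrow> \<exists>x. x extreme_point_of A"
  using extreme_point_exists_convex[OF tile_compact tile_convex tile_nonempty] by metis

lemma extreme_corner:
  assumes "y extreme_point_of (+) \<tau> ` parallelogram i j ` ({0..1} \<times> {0..1})" "i \<noteq> j"
  obtains a b where "a \<in> {0, 1}" "b \<in> {0, 1}" "y = \<tau> + \<pi> (a *\<^sub>R axis i 1 + b *\<^sub>R axis j 1)"
proof -
  let ?u = "\<pi> (axis i 1)" and ?v = "\<pi> (axis j 1)"
  let ?A = "(+) \<tau> ` parallelogram i j ` ({0..1} \<times> {0..1})"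
  have mem: "\<tau> + a *\<^sub>R ?u + b *\<^sub>R ?v \<in> ?A" if "a \<in> {0..1}" "b \<in> {0..1}" for a b
    using that by (force simp: parallelogram_def image_iff add.assoc)
  have "y \<in> ?A" using assms(1) by (simp add: extreme_point_of_def)
  then obtain a b where ab: "a \<in> {0..1}" "b \<in> {0..1}" "y = \<tau> + a *\<^sub>R ?u + b *\<^sub>R ?v"
    by (auto simp: parallelogram_def add.assoc)
  have nz: "?u \<noteq> 0" "?v \<noteq> 0" using cross_axis[OF assms(2)] by auto
  have "a \<in> {0, 1}"
  proof (rule ccontr)
    assume "a \<notin> {0, 1}"
    then have "0 < a" "a < 1" using ab by auto
    moreover have "y = (1 - a) *\<^sub>R (\<tau> + 0 *\<^sub>R ?u + b *\<^sub>R ?v) + a *\<^sub>R (\<tau> + 1 *\<^sub>R ?u + b *\<^sub>R ?v)"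
      by (simp add: ab(3) algebra_simps)
    moreover have "\<tau> + 0 *\<^sub>R ?u + b *\<^sub>R ?v \<noteq> \<tau> + 1 *\<^sub>R ?u + b *\<^sub>R ?v" using nz by simp
    ultimately have "y \<in> open_segment (\<tau> + 0 *\<^sub>R ?u + b *\<^sub>R ?v) (\<tau> + 1 *\<^sub>R ?u + b *\<^sub>R ?v)"
      unfolding in_segment by blast
    moreover have "\<tau> + 0 *\<^sub>R ?u + b *\<^sub>R ?v \<in> ?A" "\<tau> + 1 *\<^sub>R ?u + b *\<^sub>R ?v \<in> ?A"
      using ab(2) by (intro mem; simp)+
    ultimately show False using assms(1) unfolding extreme_point_of_def by blast
  qed
  moreover have "b \<in> {0, 1}"
  proof (rule ccontr)
    assume "b \<notin> {0, 1}"
    then have "0 < b" "b < 1" using ab by auto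
    moreover have "y = (1 - b) *\<^sub>R (\<tau> + a *\<^sub>R ?u + 0 *\<^sub>R ?v) + b *\<^sub>R (\<tau> + a *\<^sub>R ?u + 1 *\<^sub>R ?v)"
      by (simp add: ab(3) algebra_simps)
    moreover have "\<tau> + a *\<^sub>R ?u + 0 *\<^sub>R ?v \<noteq> \<tau> + a *\<^sub>R ?u + 1 *\<^sub>R ?v" using nz by simp
    ultimately have "y \<in> open_segment (\<tau> + a *\<^sub>R ?u + 0 *\<^sub>R ?v) (\<tau> + a *\<^sub>R ?u + 1 *\<^sub>R ?v)"
      unfolding in_segment by blast
    moreover have "\<tau> + a *\<^sub>R ?u + 0 *\<^sub>R ?v \<in> ?A" "\<tau> + a *\<^sub>R ?u + 1 *\<^sub>R ?v \<in> ?A"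
      using ab(1) by (intro mem; simp)+
    ultimately show False using assms(1) unfolding extreme_point_of_def by blast
  qed
  ultimately show ?thesis
    using that ab(3) by (simp add: linear_add[OF lin] linear_scale[OF lin] add.assoc)
qed

lemma edge_to_edge: "A \<in> \<A> \<Longrightarrow> B \<in> \<A> \<Longrightarrow> A \<noteq> B \<Longrightarrow> edge_to_edge A B"
  using tiling by (auto simp: plane_tiling_def)

text \<open>A common vertex, a common edge and the whole tile are all faces, so extreme points pass
  between a tile and its intersection with another one without case distinctions.\<close>

lemma common_face:
  assumes "A \<in> \<A>" "B \<in> \<A>" "A \<inter> B \<noteq> {}"
  shows "A \<inter> B face_of A \<and> A \<inter> B face_of B"
proof (cases "A = B")
  case True
  then show ?thesis using tile_convex[OF assms(1)] by (simp add: face_of_refl)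
next
  case False
  from edge_to_edge[OF assms(1,2) this] assms(3)
  consider x where "A \<inter> B = {x}" "x extreme_point_of A" "x extreme_point_of B"
    | "A \<inter> B edge_of A" "A \<inter> B edge_of B"
    unfolding edge_to_edge_def by blast
  then show ?thesis by cases (simp_all add: edge_of_def face_of_singleton)
qed

lemma extreme_common:
  assumes "A \<in> \<A>" "B \<in> \<A>" "x extreme_point_of A" "x \<in> B"
  shows "x extreme_point_of B"
proof -
  have x: "x \<in> A \<inter> B" using assms by (auto simp: extreme_point_of_def)
  then have "A \<inter> B face_of B" using common_face[OF assms(1,2)] by blast
  moreover have "x extreme_point_of (A \<inter> B)"
    using assms(3) x by (auto simp: extreme_point_of_def)
  ultimately show ?thesis using extreme_point_of_face by blast
qed

lemma share_vertex:
  assumes "A \<in> \<A>" "B \<in> \<A>" "A \<inter> B \<noteq> {}"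
  obtains x where "x extreme_point_of A" "x extreme_point_of B"
proof -
  have "compact (A \<inter> B)" "convex (A \<inter> B)"
    using tile_compact tile_convex assms by (auto intro: compact_Int convex_Int)
  then obtain x where "x extreme_point_of (A \<inter> B)"
    using extreme_point_exists_convex assms(3) by metis
  then show ?thesis using that common_face[OF assms] extreme_point_of_face by blast
qed

lemma interior_disjoint:
  assumes "A \<in> \<A>" "B \<in> \<A>" "A \<noteq> B"
  shows "interior (A \<inter> B) = {}"
proof (rule ccontr)
  assume ne: "interior (A \<inter> B) \<noteq> {}"
  then have "aff_dim (A \<inter> B) = 2" using aff_dim_nonempty_interior[OF ne] by simp
  then show False using edge_to_edge[OF assms] by (auto simp: edge_to_edge_def edge_of_def)
qed

text \<open>Up to translation a tile is determined by its pair of directions, so a minimum over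
  finitely many pairs works.\<close>

lemma uniform_inner_ball:
  obtains r where "r > 0" "\<And>A. A \<in> \<A> \<Longrightarrow> \<exists>c. ball c r \<subseteq> A"
proof -
  have "\<exists>r>0. \<exists>c. ball c r \<subseteq> parallelogram i j ` ({0..1} \<times> {0..1})" if ij: "i \<noteq> j" for i j
  proof -
    have "open (parallelogram i j ` ({0<..<1} \<times> {0<..<1}))"
    proof (rule open_surjective_linear_image[OF _ linear_parallelogram])
      show "surj (parallelogram i j)"
      proof (rule surjI)
        fix x
        show "parallelogram i j (cross2 x (\<pi> (axis j 1)) / cross2 (\<pi> (axis i 1)) (\<pi> (axis j 1)),
          cross2 (\<pi> (axis i 1)) x / cross2 (\<pi> (axis i 1)) (\<pi> (axis j 1))) = x"
          using cramer2[OF cross_axis[OF ij], of x] by (simp add: parallelogram_def)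
      qed
    qed (simp add: open_Times)
    moreover have "parallelogram i j (1/2, 1/2) \<in> parallelogram i j ` ({0<..<1} \<times> {0<..<1})" by auto
    ultimately obtain r where "r > 0" "ball (parallelogram i j (1/2, 1/2)) r \<subseteq> parallelogram i j ` ({0<..<1} \<times> {0<..<1})"
      using open_contains_ball by metis
    moreover have "parallelogram i j ` ({0<..<1} \<times> {0<..<1}) \<subseteq> parallelogram i j ` ({0..1} \<times> {0..1})"
      by (intro image_mono) auto
    ultimately show ?thesis by blast
  qed
  then obtain \<rho> c where \<rho>: "\<And>i j. i \<noteq> j \<Longrightarrow> \<rho> i j > 0 \<and> ball (c i j) (\<rho> i j) \<subseteq> parallelogram i j ` ({0..1} \<times> {0..1})"
    by metis
  let ?P = "{(i :: 4, j :: 4). i \<noteq> j}"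
  define r where "r = Min ((\<lambda>(i, j). \<rho> i j) ` ?P)"
  have fin: "finite ?P" by simp
  have "(0, 1) \<in> ?P" by simp
  then have ne: "(\<lambda>(i, j). \<rho> i j) ` ?P \<noteq> {}" by blast
  have "r > 0" unfolding r_def using ne \<rho> fin by (subst Min_gr_iff) auto
  moreover have "\<exists>c. ball c r \<subseteq> A" if "A \<in> \<A>" for A
  proof -
    note mem = that
    obtain \<tau> i j where ij: "i \<noteq> j" and A: "A = (+) \<tau> ` parallelogram i j ` ({0..1} \<times> {0..1})"
      by (rule tileE[OF mem])
    have "r \<le> \<rho> i j" unfolding r_def using ij fin by (intro Min_le) auto
    then have "ball (c i j) r \<subseteq> parallelogram i j ` ({0..1} \<times> {0..1})"
      using \<rho>[OF ij] subset_ball by blast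
    then have "(+) \<tau> ` ball (c i j) r \<subseteq> A" unfolding A by (rule image_mono)
    then have "ball (\<tau> + c i j) r \<subseteq> A" by (simp only: ball_translation)
    then show ?thesis by blast
  qed
  ultimately show ?thesis by (rule that)
qed

lemma uniform_diameter:
  obtains D where "\<And>A x y. A \<in> \<A> \<Longrightarrow> x \<in> A \<Longrightarrow> y \<in> A \<Longrightarrow> dist x y \<le> D"
proof -
  define D where "D = (\<Sum>i\<in>UNIV. norm (\<pi> (axis i 1))) * 2"
  have "dist x y \<le> D" if "A \<in> \<A>" "x \<in> A" "y \<in> A" for A x y
  proof -
    note mem = that
    obtain \<tau> i j where ij: "i \<noteq> j" and A: "A = (+) \<tau> ` parallelogram i j ` ({0..1} \<times> {0..1})"
      by (rule tileE[OF mem(1)])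
    let ?u = "\<pi> (axis i 1)" and ?v = "\<pi> (axis j 1)"
    obtain a b where x: "x = \<tau> + (a *\<^sub>R ?u + b *\<^sub>R ?v)" "a \<in> {0..1}" "b \<in> {0..1}"
      using mem(2) by (auto simp: A parallelogram_def)
    obtain a' b' where y: "y = \<tau> + (a' *\<^sub>R ?u + b' *\<^sub>R ?v)" "a' \<in> {0..1}" "b' \<in> {0..1}"
      using mem(3) by (auto simp: A parallelogram_def)
    have "dist x y = norm ((a - a') *\<^sub>R ?u + (b - b') *\<^sub>R ?v)"
      by (simp add: dist_norm x(1) y(1) algebra_simps)
    also have "\<dots> \<le> \<bar>a - a'\<bar> * norm ?u + \<bar>b - b'\<bar> * norm ?v"
      by (rule norm_triangle_le) simp
    also have "\<dots> \<le> 1 * norm ?u + 1 * norm ?v"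
      using x y by (intro add_mono mult_right_mono) auto
    also have "\<dots> \<le> D"
      using member_le_sum[of i UNIV "\<lambda>i. norm (\<pi> (axis i 1))"] member_le_sum[of j UNIV "\<lambda>i. norm (\<pi> (axis i 1))"]
      by (simp add: D_def)
    finally show ?thesis .
  qed
  then show ?thesis by (rule that)
qed

text \<open>Different tiles have no common interior point, so the centres of their inner balls are
  \<open>r\<close>-separated, and they lie within \<open>R + D\<close> of \<open>z\<close>.\<close>

lemma tile_count_bound:
  fixes R :: real
  obtains N where "\<And>z. finite {A \<in> \<A>. A \<inter> cball z R \<noteq> {}} \<and> card {A \<in> \<A>. A \<inter> cball z R \<noteq> {}} \<le> N"
proof -
  obtain r where r: "r > 0" "\<And>A. A \<in> \<A> \<Longrightarrow> \<exists>c. ball c r \<subseteq> A" using uniform_inner_ball by blast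
  then obtain c where c: "\<And>A. A \<in> \<A> \<Longrightarrow> ball (c A) r \<subseteq> A" by metis
  obtain D where D: "\<And>A x y. A \<in> \<A> \<Longrightarrow> x \<in> A \<Longrightarrow> y \<in> A \<Longrightarrow> dist x y \<le> D" using uniform_diameter by blast
  obtain N where N: "\<And>(z :: real^2) S. S \<subseteq> cball z (R + D) \<Longrightarrow>
    (\<And>x y. x \<in> S \<Longrightarrow> y \<in> S \<Longrightarrow> x \<noteq> y \<Longrightarrow> r \<le> dist x y) \<Longrightarrow> finite S \<and> card S \<le> N"
    by (rule separated_card_bound[OF r(1), of "R + D"]) blast
  have sep: "r \<le> dist (c A) (c B)" if "A \<in> \<A>" "B \<in> \<A>" "A \<noteq> B" for A B
  proof (rule ccontr)
    assume "\<not> r \<le> dist (c A) (c B)"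
    then have "c A \<in> ball (c A) r \<inter> ball (c B) r" using r(1) by (simp add: dist_commute)
    moreover have "ball (c A) r \<inter> ball (c B) r \<subseteq> interior (A \<inter> B)"
      using c that by (intro interior_maximal) auto
    ultimately show False using interior_disjoint[OF that] by blast
  qed
  have "finite {A \<in> \<A>. A \<inter> cball z R \<noteq> {}} \<and> card {A \<in> \<A>. A \<inter> cball z R \<noteq> {}} \<le> N" for z
  proof -
    let ?\<F> = "{A \<in> \<A>. A \<inter> cball z R \<noteq> {}}"
    have inj: "inj_on c ?\<F>" using sep r(1) by (force simp: inj_on_def)
    have "c ` ?\<F> \<subseteq> cball z (R + D)"
    proof
      fix y assume "y \<in> c ` ?\<F>"
      then obtain A where y: "y = c A" and "A \<in> ?\<F>" by blast
      then obtain x where A: "A \<in> \<A>" "x \<in> A" "dist z x \<le> R" by auto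
      have "c A \<in> A" using c[OF A(1)] r(1) by auto
      then have "dist x (c A) \<le> D" using D A by blast
      then show "y \<in> cball z (R + D)" using A(3) dist_triangle[of z "c A" x] y by simp
    qed
    then have "finite (c ` ?\<F>) \<and> card (c ` ?\<F>) \<le> N"
      using sep by (intro N) blast+
    then show ?thesis using inj by (simp add: card_image finite_image_iff)
  qed
  then show ?thesis by (rule that)
qed

text \<open>The nearby tiles that miss \<open>z\<close> are finitely many and have a closed union,
  so a short step from \<open>z\<close> ends in a tile that also contains \<open>z\<close>. This
  yields bar segments of positive length.\<close>

lemma tile_in_direction:
  assumes "v \<noteq> 0"
  obtains A s where "A \<in> \<A>" "z \<in> A" "s \<noteq> 0" "z + s *\<^sub>R v \<in> A"
proof -
  let ?\<F> = "{A \<in> \<A>. A \<inter> cball z 1 \<noteq> {}}" 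
  have fin: "finite ?\<F>" by (rule tile_count_bound[of 1]) blast
  let ?U = "\<Union>{A \<in> ?\<F>. z \<notin> A}"
  have "closed ?U"
    by (rule closed_Union) (use fin tile_closed in \<open>auto intro: finite_subset[of _ ?\<F>]\<close>)
  moreover have "z \<notin> ?U" by blast
  ultimately have "open (- ?U)" "z \<in> - ?U" by auto
  then obtain e where e: "e > 0" "ball z e \<subseteq> - ?U"
    by (rule openE)
  \<comment> \<open>The cap 1 keeps the end point in the ball whose tiles were counted;
    \<open>e / 2\<close> keeps it away from the tiles that miss \<open>z\<close>.\<close>
  define s where "s = min 1 (e / 2) / norm v"
  have s: "s > 0" using e(1) assms by (simp add: s_def)
  have "norm (s *\<^sub>R v) = min 1 (e / 2)" using assms e(1) by (simp add: s_def)
  then have d: "dist z (z + s *\<^sub>R v) \<le> 1" "dist z (z + s *\<^sub>R v) < e" using e(1) by (auto simp: dist_norm)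
  obtain A where A: "A \<in> \<A>" "z + s *\<^sub>R v \<in> A" using cover by blast
  then have "A \<in> ?\<F>" using d(1) by auto
  moreover have "z + s *\<^sub>R v \<in> ball z e" using d(2) by simp
  then have "z + s *\<^sub>R v \<notin> ?U" using e(2) by blast
  ultimately have "z \<in> A" using A(2) by blast
  then show ?thesis using that A s by (metis less_irrefl)
qed

text \<open>The segment from \<open>x\<close> to \<open>y\<close> stays in a ball of radius
  \<open>R\<close>, which meets boundedly many tiles. The bound is fixed before \<open>F\<close> and
  the points.\<close>

lemma tile_chain_bound:
  fixes R c :: real
  obtains N where "\<And>(F :: (real^2) set \<Rightarrow> 'b::metric_space) A B x y.
    (\<And>A B. A \<in> \<A> \<Longrightarrow> B \<in> \<A> \<Longrightarrow> A \<inter> B \<noteq> {} \<Longrightarrow> dist (F A) (F B) \<le> c) \<Longrightarrow>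
    A \<in> \<A> \<Longrightarrow> B \<in> \<A> \<Longrightarrow> x \<in> A \<Longrightarrow> y \<in> B \<Longrightarrow> dist x y \<le> R \<Longrightarrow> dist (F A) (F B) \<le> N"
proof -
  obtain N where N: "\<And>z. finite {A \<in> \<A>. A \<inter> cball z R \<noteq> {}} \<and> card {A \<in> \<A>. A \<inter> cball z R \<noteq> {}} \<le> N"
    by (rule tile_count_bound[of R]) blast
  have "dist (F A) (F B) \<le> real N * \<bar>c\<bar>"
    if F: "\<And>A B. A \<in> \<A> \<Longrightarrow> B \<in> \<A> \<Longrightarrow> A \<inter> B \<noteq> {} \<Longrightarrow> dist (F A) (F B) \<le> c"
      and AB: "A \<in> \<A>" "B \<in> \<A>" "x \<in> A" "y \<in> B" "dist x y \<le> R"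
    for F :: "(real^2) set \<Rightarrow> 'b" and A B x y
  proof -
    let ?\<F> = "{A \<in> \<A>. A \<inter> cball x R \<noteq> {}}"
    have fin: "finite ?\<F>" and card: "card ?\<F> \<le> N" using N by blast+
    have R: "0 \<le> R" using AB(5) zero_le_dist[of x y] by linarith
    have seg: "closed_segment x y \<subseteq> cball x R"
      using AB(5) R by (intro closed_segment_subset) auto
    have "dist (F A) (F B) \<le> real (card ?\<F>) * \<bar>c\<bar>"
    proof (rule finite_closed_cover_chain[OF fin])
      show "connected (closed_segment x y)" by simp
      show "closed_segment x y \<subseteq> \<Union>?\<F>" using seg cover by blast
      show "closed A" if "A \<in> ?\<F>" for A using that tile_closed by auto
      show "dist (F A) (F B) \<le> \<bar>c\<bar>" if "A \<in> ?\<F>" "B \<in> ?\<F>" "A \<inter> B \<noteq> {}" for A B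
        using F[of A B] that by fastforce
      show "A \<in> ?\<F>" "B \<in> ?\<F>" using AB R by auto
      show "A \<inter> closed_segment x y \<noteq> {}" "B \<inter> closed_segment x y \<noteq> {}" using AB by auto
    qed
    also have "\<dots> \<le> real N * \<bar>c\<bar>" using card by (intro mult_right_mono) auto
    finally show ?thesis .
  qed
  then show ?thesis by (rule that)
qed

lemma tiles_connected:
  assumes step: "\<And>A B. A \<in> \<A> \<Longrightarrow> B \<in> \<A> \<Longrightarrow> A \<inter> B \<noteq> {} \<Longrightarrow> P A \<Longrightarrow> P B"
    and A: "A \<in> \<A>" "P A" and B: "B \<in> \<A>"
  shows "P B"
proof -
  obtain x y where xy: "x \<in> A" "y \<in> B" using tile_nonempty A B by blast
  let ?\<F> = "{A \<in> \<A>. A \<inter> cball x (dist x y) \<noteq> {}}"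
  have fin: "finite ?\<F>" by (rule tile_count_bound[of "dist x y"]) blast
  have seg: "closed_segment x y \<subseteq> cball x (dist x y)"
    by (intro closed_segment_subset) auto
  show ?thesis
  proof (rule finite_closed_cover_connected[OF fin, where P = P])
    show "connected (closed_segment x y)" by simp
    show "closed_segment x y \<subseteq> \<Union>?\<F>" using seg cover by blast
    show "closed A" if "A \<in> ?\<F>" for A using that tile_closed by auto
    show "P B" if "A \<in> ?\<F>" "B \<in> ?\<F>" "A \<inter> B \<noteq> {}" "P A" for A B
      using step that by blast
    show "A \<in> ?\<F>" "B \<in> ?\<F>" "P A" using A B xy by auto
    show "A \<inter> closed_segment x y \<noteq> {}" "B \<inter> closed_segment x y \<noteq> {}" using xy by auto
  qed
qed

end

section \<open>Lattice coordinates of vertices\<close>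

locale lifted_tiling = parallelogram_tiling +
  fixes x0 :: "real^2"
  assumes lattice_inj: "\<And>m. m \<in> integer_lattice \<Longrightarrow> \<pi> m = 0 \<Longrightarrow> m = 0"
    and x0: "x0 \<in> tiling_vertices \<A>"
begin

lemma extreme_difference:
  assumes "A \<in> \<A>" "y extreme_point_of A" "y' extreme_point_of A"
  obtains m where "m \<in> integer_lattice" "norm m \<le> 2" "y - y' = \<pi> m"
proof -
  obtain \<tau> i j where ij: "i \<noteq> j" and A: "A = (+) \<tau> ` parallelogram i j ` ({0..1} \<times> {0..1})"
    by (rule tileE[OF assms(1)])
  obtain a b where ab: "a \<in> {0, 1}" "b \<in> {0, 1}" "y = \<tau> + \<pi> (a *\<^sub>R axis i 1 + b *\<^sub>R axis j 1)"
    using assms(2) extreme_corner[OF _ ij] unfolding A by metis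
  obtain a' b' where ab': "a' \<in> {0, 1}" "b' \<in> {0, 1}" "y' = \<tau> + \<pi> (a' *\<^sub>R axis i 1 + b' *\<^sub>R axis j 1)"
    using assms(3) extreme_corner[OF _ ij] unfolding A by metis
  let ?m = "(a - a') *\<^sub>R axis i (1::real) + (b - b') *\<^sub>R axis j 1"
  have "norm ?m \<le> \<bar>a - a'\<bar> + \<bar>b - b'\<bar>"
    by (rule norm_triangle_le) simp
  also have "\<dots> \<le> 2" using ab ab' by auto
  finally have "norm ?m \<le> 2" .
  moreover have "?m \<in> integer_lattice" using ab ab' by (auto simp: integer_lattice_def axis_def)
  moreover have "y - y' = \<pi> ?m"
    unfolding ab(3) ab'(3) linear_add[OF lin] linear_scale[OF lin] by (simp add: algebra_simps)
  ultimately show ?thesis using that by blast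
qed

text \<open>Vertices of one tile differ by projected lattice vectors and touching tiles share a
  vertex, so the property spreads from a tile at \<open>x0\<close> to all tiles.\<close>

lemma vertex_lattice:
  assumes "x \<in> tiling_vertices \<A>"
  shows "\<exists>m. m \<in> integer_lattice \<and> x = x0 + \<pi> m"
proof -
  obtain A where A: "A \<in> \<A>" "x0 extreme_point_of A" using x0 by (auto simp: tiling_vertices_def)
  obtain B where B: "B \<in> \<A>" "x extreme_point_of B" using assms by (auto simp: tiling_vertices_def)
  let ?P = "\<lambda>A. \<forall>y. y extreme_point_of A \<longrightarrow> (\<exists>m. m \<in> integer_lattice \<and> y = x0 + \<pi> m)"
  have move: "\<exists>m. m \<in> integer_lattice \<and> y = x0 + \<pi> m"
    if "A \<in> \<A>" "z extreme_point_of A" "y extreme_point_of A" "n \<in> integer_lattice" "z = x0 + \<pi> n" for A y z n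
  proof -
    note ext = that(1,3,2)
    obtain m where m: "m \<in> integer_lattice" "y - z = \<pi> m"
      by (rule extreme_difference[OF ext])
    have "y = z + \<pi> m" using m(2) by (simp add: algebra_simps)
    then have "y = x0 + \<pi> (m + n)" unfolding that(5) by (simp add: linear_add[OF lin] algebra_simps)
    then show ?thesis using m(1) that(4) integer_lattice_add by blast
  qed
  have "?P B"
  proof (rule tiles_connected[where P = ?P, OF _ A(1) _ B(1)])
    show "?P A"
      using move[OF A(1,2) _ integer_lattice_zero] by (simp add: linear_0[OF lin])
    fix A B assume AB: "A \<in> \<A>" "B \<in> \<A>" "A \<inter> B \<noteq> {}" "?P A"
    obtain z where z: "z extreme_point_of A" "z extreme_point_of B" using share_vertex[OF AB(1-3)] by blast
    obtain n where "n \<in> integer_lattice" "z = x0 + \<pi> n" using AB(4) z(1) by blast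
    then show "?P B" using move[OF AB(2) z(2)] by blast
  qed
  then show ?thesis using B(2) by blast
qed

definition lift :: "real^2 \<Rightarrow> real^4" where
  "lift x = (SOME m. m \<in> integer_lattice \<and> x = x0 + \<pi> m)"

lemma lift:
  assumes "x \<in> tiling_vertices \<A>"
  shows "lift x \<in> integer_lattice" "x = x0 + \<pi> (lift x)"
  using someI_ex[OF vertex_lattice[OF assms]] unfolding lift_def by blast+

lemma lift_unique:
  assumes "x \<in> tiling_vertices \<A>" "m \<in> integer_lattice" "x = x0 + \<pi> m"
  shows "lift x = m"
proof -
  have "\<pi> (lift x - m) = 0"
    using lift(2)[OF assms(1)] assms(3) by (simp add: linear_diff[OF lin])
  then show ?thesis using lattice_inj[of "lift x - m"] integer_lattice_diff lift(1)[OF assms(1)] assms(2) by simp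
qed

lemma lift_x0: "lift x0 = 0"
  by (rule lift_unique[OF x0 integer_lattice_zero]) (simp add: linear_0[OF lin])

lemma extreme_vertex: "A \<in> \<A> \<Longrightarrow> x extreme_point_of A \<Longrightarrow> x \<in> tiling_vertices \<A>"
  by (auto simp: tiling_vertices_def)

lemma lift_same_tile:
  assumes "A \<in> \<A>" "y extreme_point_of A" "y' extreme_point_of A"
  shows "dist (lift y) (lift y') \<le> 2"
proof -
  obtain m where m: "m \<in> integer_lattice" "norm m \<le> 2" "y - y' = \<pi> m"
    using extreme_difference[OF assms] .
  note V = extreme_vertex[OF assms(1,2)] extreme_vertex[OF assms(1,3)]
  have "y = y' + \<pi> m" using m(3) by (simp add: algebra_simps)
  also have "\<dots> = x0 + \<pi> (lift y' + m)"
    by (subst lift(2)[OF V(2)]) (simp add: linear_add[OF lin])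
  finally have "lift y = lift y' + m"
    by (rule lift_unique[OF V(1) integer_lattice_add[OF lift(1)[OF V(2)] m(1)]])
  then show ?thesis using m(2) by (simp add: dist_norm)
qed

lemma lift_touching:
  assumes "A \<in> \<A>" "B \<in> \<A>" "A \<inter> B \<noteq> {}" "y extreme_point_of A" "y' extreme_point_of B"
  shows "dist (lift y) (lift y') \<le> 4"
proof -
  obtain z where "z extreme_point_of A" "z extreme_point_of B" using share_vertex[OF assms(1-3)] by blast
  then have "dist (lift y) (lift z) \<le> 2" "dist (lift z) (lift y') \<le> 2"
    using lift_same_tile assms by blast+
  then show ?thesis using dist_triangle[of "lift y" "lift y'" "lift z"] by linarith
qed

text \<open>Extends \<open>lift\<close> to the whole plane up to bounded error, through an arbitrary
  vertex of an arbitrary tile at the point. At a vertex it need not agree with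
  \<open>lift\<close>.\<close>

definition point_lift :: "real^2 \<Rightarrow> real^4" where
  "point_lift z = lift (SOME y. \<exists>A\<in>\<A>. z \<in> A \<and> y extreme_point_of A)"

lemma point_lift_obtain:
  obtains A y where "A \<in> \<A>" "z \<in> A" "y extreme_point_of A" "point_lift z = lift y"
proof -
  have "\<exists>y. \<exists>A\<in>\<A>. z \<in> A \<and> y extreme_point_of A" using cover extreme_exists by metis
  from someI_ex[OF this] show ?thesis using that unfolding point_lift_def by blast
qed

lemma point_lift_near:
  assumes "A \<in> \<A>" "z \<in> A" "y extreme_point_of A"
  shows "dist (point_lift z) (lift y) \<le> 4"
proof -
  obtain B y' where B: "B \<in> \<A>" "z \<in> B" "y' extreme_point_of B" "point_lift z = lift y'"
    by (rule point_lift_obtain)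
  then show ?thesis using lift_touching[OF B(1) assms(1) _ B(3) assms(3)] assms(2) by auto
qed

lemma point_lift_coarse_lipschitz:
  fixes R :: real
  obtains C where "\<And>z z'. dist z z' \<le> R \<Longrightarrow> dist (point_lift z) (point_lift z') \<le> C"
proof -
  obtain N where N: "\<And>(F :: (real^2) set \<Rightarrow> real^4) A B x y.
    (\<And>A B. A \<in> \<A> \<Longrightarrow> B \<in> \<A> \<Longrightarrow> A \<inter> B \<noteq> {} \<Longrightarrow> dist (F A) (F B) \<le> 4) \<Longrightarrow>
    A \<in> \<A> \<Longrightarrow> B \<in> \<A> \<Longrightarrow> x \<in> A \<Longrightarrow> y \<in> B \<Longrightarrow> dist x y \<le> R \<Longrightarrow> dist (F A) (F B) \<le> N"
    by (rule tile_chain_bound[of 4 R]) blast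
  obtain e where e: "\<And>A. A \<in> \<A> \<Longrightarrow> e A extreme_point_of A" using extreme_exists by metis
  have "dist (point_lift z) (point_lift z') \<le> 4 + N + 4" if "dist z z' \<le> R" for z z'
  proof -
    obtain A B where AB: "A \<in> \<A>" "z \<in> A" "B \<in> \<A>" "z' \<in> B" using cover by metis
    have "dist (lift (e A)) (lift (e B)) \<le> N"
      by (rule N[of "\<lambda>A. lift (e A)", OF _ AB(1,3,2,4) that]) (use lift_touching e in blast)
    moreover have "dist (point_lift z) (lift (e A)) \<le> 4" "dist (point_lift z') (lift (e B)) \<le> 4"
      using point_lift_near AB e by blast+
    ultimately show ?thesis
      using dist_triangle[of "point_lift z" "point_lift z'" "lift (e A)"]
        dist_triangle[of "lift (e A)" "point_lift z'" "lift (e B)"] by (simp add: dist_commute)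
  qed
  then show ?thesis by (rule that)
qed

section \<open>Lattice coordinates under a period\<close>

context
  fixes t :: "real^2" and q :: "real^4"
  assumes period: "\<And>A. A \<in> \<A> \<Longrightarrow> (+) t ` A \<in> \<A>" and q: "q \<in> integer_lattice" "t = \<pi> q"
begin

lemma period_vertex: "A \<in> \<A> \<Longrightarrow> y extreme_point_of A \<Longrightarrow> t + y extreme_point_of (+) t ` A"
  by (simp add: extreme_point_of_translation_eq)

text \<open>Translating a vertex changes its lift by exactly \<open>n\<close> times
  \<open>q\<close>. The error stems only from the vertex chosen by \<open>point_lift\<close>, so it
  does not grow with \<open>n\<close>.\<close>

lemma point_lift_period_nat:
  "dist (point_lift (z + real n *\<^sub>R t)) (point_lift z + real n *\<^sub>R q) \<le> 4"
proof -
  obtain A y where A: "A \<in> \<A>" "z \<in> A" "y extreme_point_of A" "point_lift z = lift y"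
    by (rule point_lift_obtain)
  have "\<exists>B\<in>\<A>. z + real n *\<^sub>R t \<in> B \<and> y + real n *\<^sub>R t extreme_point_of B"
  proof (induction n)
    case 0
    then show ?case using A by auto
  next
    case (Suc n)
    then obtain B where B: "B \<in> \<A>" "z + real n *\<^sub>R t \<in> B" "y + real n *\<^sub>R t extreme_point_of B" by blast
    have "t + (z + real n *\<^sub>R t) \<in> (+) t ` B" using B(2) by blast
    moreover have "t + (y + real n *\<^sub>R t) extreme_point_of (+) t ` B" using period_vertex B by blast
    ultimately show ?case using period[OF B(1)] by (intro bexI[of _ "(+) t ` B"]) (simp_all add: algebra_simps)
  qed
  then obtain B where B: "B \<in> \<A>" "z + real n *\<^sub>R t \<in> B" "y + real n *\<^sub>R t extreme_point_of B" by blast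
  note V = extreme_vertex[OF A(1,3)] extreme_vertex[OF B(1,3)]
  have "lift (y + real n *\<^sub>R t) = lift y + real n *\<^sub>R q"
  proof (rule lift_unique[OF V(2)])
    have "real n *\<^sub>R q \<in> integer_lattice" using q(1) by (auto simp: integer_lattice_def)
    then show "lift y + real n *\<^sub>R q \<in> integer_lattice" using lift(1)[OF V(1)] integer_lattice_add by blast
    have "y + real n *\<^sub>R t = x0 + \<pi> (lift y) + real n *\<^sub>R \<pi> q"
      using lift(2)[OF V(1)] q(2) by simp
    then show "y + real n *\<^sub>R t = x0 + \<pi> (lift y + real n *\<^sub>R q)"
      by (simp add: linear_add[OF lin] linear_scale[OF lin])
  qed
  then show ?thesis using point_lift_near[OF B] A(4) by simp
qed

lemma point_lift_period_int:
  "dist (point_lift (z + of_int n *\<^sub>R t)) (point_lift z + of_int n *\<^sub>R q) \<le> 4"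
proof (cases "n \<ge> 0")
  case True
  then show ?thesis using point_lift_period_nat[of z "nat n"] by simp
next
  case False
  \<comment> \<open>Only forward translates of tiles are assumed to be tiles, so a negative
    \<open>n\<close> is handled by starting from the translated point.\<close>
  have "dist (point_lift (z + of_int n *\<^sub>R t + real (nat (- n)) *\<^sub>R t))
    (point_lift (z + of_int n *\<^sub>R t) + real (nat (- n)) *\<^sub>R q) \<le> 4"
    by (rule point_lift_period_nat)
  moreover have "real (nat (- n)) = - of_int n" using False by simp
  ultimately have "dist (point_lift z) (point_lift (z + of_int n *\<^sub>R t) - of_int n *\<^sub>R q) \<le> 4" by simp
  then show ?thesis by (simp add: dist_norm norm_minus_commute algebra_simps)
qed

text \<open>Rounding \<open>r\<close> down leaves a step of length at most \<open>norm t\<close>,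
  which changes \<open>point_lift\<close> by a bounded amount.\<close>

lemma point_lift_period_real:
  obtains C where "\<And>z r. norm (point_lift (z + r *\<^sub>R t) - point_lift z - r *\<^sub>R q) \<le> C"
proof -
  obtain C where C: "\<And>z z'. dist z z' \<le> norm t \<Longrightarrow> dist (point_lift z) (point_lift z') \<le> C"
    by (rule point_lift_coarse_lipschitz[of "norm t"]) blast
  have "norm (point_lift (z + r *\<^sub>R t) - point_lift z - r *\<^sub>R q) \<le> C + 4 + norm q" for z r
  proof -
    let ?n = "\<lfloor>r\<rfloor>"
    have f: "\<bar>r - of_int ?n\<bar> \<le> 1" by linarith
    have "dist (z + r *\<^sub>R t) (z + of_int ?n *\<^sub>R t) = \<bar>r - of_int ?n\<bar> * norm t"
      by (simp add: dist_norm flip: scaleR_diff_left)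
    also have "\<dots> \<le> norm t" using mult_right_mono[OF f, of "norm t"] by simp
    finally have 1: "norm (point_lift (z + r *\<^sub>R t) - point_lift (z + of_int ?n *\<^sub>R t)) \<le> C"
      using C by (simp add: dist_norm)
    have 2: "norm (point_lift (z + of_int ?n *\<^sub>R t) - (point_lift z + of_int ?n *\<^sub>R q)) \<le> 4"
      using point_lift_period_int[of z ?n] by (simp add: dist_norm)
    have 3: "norm ((of_int ?n - r) *\<^sub>R q) \<le> norm q"
      using mult_right_mono[OF f, of "norm q"] by (simp add: abs_minus_commute)
    have "point_lift (z + r *\<^sub>R t) - point_lift z - r *\<^sub>R q =
      (point_lift (z + r *\<^sub>R t) - point_lift (z + of_int ?n *\<^sub>R t)) +
      (point_lift (z + of_int ?n *\<^sub>R t) - (point_lift z + of_int ?n *\<^sub>R q)) + (of_int ?n - r) *\<^sub>R q"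
      by (simp add: algebra_simps)
    then show ?thesis using 1 2 3 norm_triangle_le
      by (metis (no_types, lifting) add_mono norm_triangle_mono)
  qed
  then show ?thesis by (rule that)
qed

end

end

section \<open>Ammann bars\<close>

text \<open>Subtracting multiples of \<open>k\<close> does not shorten the component
  \<open>v\<close> of \<open>g\<close> orthogonal to \<open>k\<close>, and
  \<open>s *\<^sub>R v\<close> is unbounded in \<open>s\<close> unless \<open>v = 0\<close>.\<close>

lemma multiples_near_line:
  fixes g k :: "'a::real_inner"
  assumes "k \<noteq> 0" and near: "\<And>s::real. \<exists>l. norm (s *\<^sub>R g - l *\<^sub>R k) \<le> C"
  shows "\<exists>\<mu>. g = \<mu> *\<^sub>R k"
proof -
  define v where "v = g - ((g \<bullet> k) / (k \<bullet> k)) *\<^sub>R k"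
  have vk: "k \<bullet> v = 0" using assms(1) by (simp add: v_def inner_diff_right inner_commute)
  have gv: "g \<bullet> v = v \<bullet> v"
  proof -
    have "g = v + ((g \<bullet> k) / (k \<bullet> k)) *\<^sub>R k" by (simp add: v_def)
    then have "g \<bullet> v = (v + ((g \<bullet> k) / (k \<bullet> k)) *\<^sub>R k) \<bullet> v" by (rule arg_cong)
    then show ?thesis by (simp only: inner_add_left inner_scaleR_left vk)
  qed
  have "v = 0"
  proof (rule ccontr)
    assume "v \<noteq> 0"
    then have pos: "norm v > 0" by simp
    define s where "s = (\<bar>C\<bar> + 1) / norm v"
    obtain l where l: "norm (s *\<^sub>R g - l *\<^sub>R k) \<le> C" using near by blast
    have "s * (norm v)\<^sup>2 = (s *\<^sub>R g - l *\<^sub>R k) \<bullet> v"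
      by (simp add: inner_diff_left vk gv power2_norm_eq_inner)
    also have "\<dots> \<le> norm (s *\<^sub>R g - l *\<^sub>R k) * norm v" by (rule norm_cauchy_schwarz)
    also have "\<dots> \<le> C * norm v" using l by (intro mult_right_mono) auto
    finally have "s * norm v \<le> C" using pos by (simp add: power2_eq_square)
    then show False using pos by (simp add: s_def)
  qed
  then show ?thesis unfolding v_def by (metis right_minus_eq)
qed

lemma affine_hull_line:
  fixes v :: "'a::real_vector"
  assumes S: "S \<subseteq> {x + t *\<^sub>R v | t. True}" and y: "y \<in> S" "y' \<in> S" "y \<noteq> y'"
  shows "affine hull S = {x + t *\<^sub>R v | t. True}"
proof
  have "affine {x + t *\<^sub>R v | t. True}"
    unfolding affine_def
  proof clarify
    fix a b m n :: real assume "m + n = 1"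
    then have "m *\<^sub>R (x + a *\<^sub>R v) + n *\<^sub>R (x + b *\<^sub>R v) = x + (m * a + n * b) *\<^sub>R v"
      by (simp add: algebra_simps flip: scaleR_add_left)
    then show "\<exists>t. m *\<^sub>R (x + a *\<^sub>R v) + n *\<^sub>R (x + b *\<^sub>R v) = x + t *\<^sub>R v \<and> True" by blast
  qed
  then show "affine hull S \<subseteq> {x + t *\<^sub>R v | t. True}" using S by (intro hull_minimal)
  show "{x + t *\<^sub>R v | t. True} \<subseteq> affine hull S"
  proof clarify
    fix t
    obtain a b where ab: "y = x + a *\<^sub>R v" "y' = x + b *\<^sub>R v" using S y by blast
    then have "b - a \<noteq> 0" using y(3) by auto
    define u where "u = (t - a) / (b - a)"
    have u: "a + u * (b - a) = t" using \<open>b - a \<noteq> 0\<close> by (simp add: u_def)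
    have "(1 - u) *\<^sub>R y + u *\<^sub>R y' = x + (a + u * (b - a)) *\<^sub>R v"
      by (simp add: ab algebra_simps)
    then have "x + t *\<^sub>R v = (1 - u) *\<^sub>R y + u *\<^sub>R y'" using u by simp
    also have "\<dots> \<in> affine hull S"
      using y by (intro mem_affine[OF affine_affine_hull]) (auto intro: hull_inc)
    finally show "x + t *\<^sub>R v \<in> affine hull S" .
  qed
qed

lemma norm_sum3_le:
  fixes a b c :: "'a::real_normed_vector"
  assumes "norm a \<le> A" "norm b \<le> B" "norm c \<le> C"
  shows "norm (a - b + c) \<le> A + B + C" "norm (a - b - c) \<le> A + B + C" "norm (a + b - c) \<le> A + B + C"
  using assms norm_triangle_ineq4[of a b] norm_triangle_ineq[of a b] norm_triangle_ineq[of "a - b" c]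
    norm_triangle_ineq4[of "a - b" c] norm_triangle_ineq4[of "a + b" c] by linarith+

lemma linear_bound:
  fixes f :: "'a::euclidean_space \<Rightarrow> 'b::real_normed_vector"
  assumes "linear f"
  obtains B where "B \<ge> 0" "\<And>x. norm (f x) \<le> B * norm x"
  using linear_bounded_pos[OF assms] by (metis less_imp_le)

lemma norm_unit_cube: "u \<in> unit_cube \<Longrightarrow> norm u \<le> 4"
proof -
  assume "u \<in> unit_cube"
  then have "(\<Sum>i\<in>UNIV. \<bar>u $ i\<bar>) \<le> (\<Sum>i\<in>(UNIV :: 4 set). 1)"
    by (intro sum_mono) (auto simp: unit_cube_def)
  then show ?thesis using norm_le_l1_cart[of u] by simp
qed

section \<open>Coarsely linear maps into the kernel\<close>

context fine_slope
begin

text \<open>The projection onto the kernel of \<pi> along \<open>E\<close>.\<close>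

definition \<psi> :: "real^4 \<Rightarrow> real^4" where "\<psi> v = v - \<sigma> (\<pi> v)"

lemma linear_\<psi>: "linear \<psi>"
  by (rule linearI)
    (simp_all add: \<psi>_def \<pi>_simps linear_add[OF linear_\<sigma>] linear_scale[OF linear_\<sigma>] algebra_simps)

lemmas \<psi>_simps = linear_add[OF linear_\<psi>] linear_diff[OF linear_\<psi>] linear_scale[OF linear_\<psi>]

lemma \<psi>_E: "v \<in> E \<Longrightarrow> \<psi> v = 0"
  by (simp add: \<psi>_def \<sigma>_\<pi>)

lemma \<psi>_axis: "\<psi> (axis i 1) = (- \<kappa> i) *\<^sub>R k i"
  by (simp add: \<psi>_def \<pi>_axis linear_scale[OF linear_\<sigma>] \<sigma>_\<pi>[OF p_mem] k_def scaleR_diff_right \<kappa>_nz)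

lemma \<psi>_eq_0: "\<psi> v = 0 \<Longrightarrow> v \<in> E"
  using \<sigma>_mem[of "\<pi> v"] by (simp add: \<psi>_def)

lemma dual_functional:
  assumes "j \<noteq> l"
  obtains f :: "real^4 \<Rightarrow> real" where "linear f" "f (k j) = 1" "f (k l) = 0"
proof -
  have "independent {k j, k l}"
  proof -
    have "k j \<noteq> k l" using k_independent[OF assms, of 1] by auto
    moreover have "k j \<notin> span {k l}"
      using k_independent[OF assms] by (auto simp: span_singleton)
    moreover have "independent {k l}" using k_nz by simp
    ultimately show ?thesis by (simp add: independent_insert)
  qed
  then obtain f :: "real^4 \<Rightarrow> real" where f: "linear f" "\<forall>x\<in>{k j, k l}. f x = (if x = k j then 1 else 0)"
    using linear_independent_extend[of "{k j, k l}" "\<lambda>x. if x = k j then 1 else 0 :: real"] by blast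
  moreover have "k l \<noteq> k j" using k_independent[OF assms, of 1] by auto
  ultimately show ?thesis by (intro that[of f]) auto
qed

text \<open>Along the directions \<open>d j\<close> and \<open>d l\<close>, both transversal to \<open>t\<close>, the function \<open>H\<close> is forced to be
  linear up to a bounded error by the independence of \<open>k j\<close> and \<open>k l\<close>; its linear part is then a
  deformation of the slope.\<close>

lemma coarsely_linear_absurd:
  fixes H :: "real^2 \<Rightarrow> real^4"
  assumes "t \<noteq> 0" "w \<noteq> 0"
    and period: "\<And>z r. norm (H (z + r *\<^sub>R t) - H z - r *\<^sub>R w) \<le> C"
    and bars: "\<And>i s. \<exists>l. norm (H (x0 + s *\<^sub>R d i) - H x0 - l *\<^sub>R k i) \<le> C"
  shows False
proof -
  \<comment> \<open>\<open>t\<close> is parallel to at most one \<open>d i\<close>, so two of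
    \<open>d 0\<close>, \<open>d 1\<close>, \<open>d 2\<close> are transversal to it.\<close>
  have one: "i = i'" if "cross2 (d i) t = 0" "cross2 (d i') t = 0" for i i'
  proof (rule ccontr)
    assume "i \<noteq> i'"
    from cramer2[OF d_cross[OF this], of t] that have "t = 0"
      using cross2_commute[of "d i'" t] by simp
    then show False using assms(1) by simp
  qed
  obtain j l where jl: "j \<noteq> l" "cross2 (d j) t \<noteq> 0" "cross2 (d l) t \<noteq> 0"
  proof (cases "cross2 (d 0) t = 0")
    case True
    then show ?thesis using that[of 1 2] one[of 0 1] one[of 0 2] by auto
  next
    case False
    then show ?thesis using that[of 0 1] that[of 0 2] one[of 1 2] by fastforce
  qed
  define \<alpha> where "\<alpha> x = cross2 x t / cross2 (d j) t" for x
  define \<beta> where "\<beta> x = cross2 (d j) x / cross2 (d j) t" for x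
  have decomp: "x = \<alpha> x *\<^sub>R d j + \<beta> x *\<^sub>R t" for x
    unfolding \<alpha>_def \<beta>_def by (rule cramer2[OF jl(2)])
  have \<alpha>l: "\<alpha> (d l) \<noteq> 0" using jl by (simp add: \<alpha>_def)
  obtain f :: "real^4 \<Rightarrow> real" where f: "linear f" "f (k j) = 1" "f (k l) = 0"
    using dual_functional[OF jl(1)] by blast
  obtain B where B: "B \<ge> 0" "\<And>x. norm (f x) \<le> B * norm x" using linear_bound[OF f(1)] by blast
  \<comment> \<open>The value at \<open>x0 + s *\<^sub>R d j\<close> differs from one on the bar of
    direction \<open>d l\<close> by the multiple of \<open>w\<close> collected along
    \<open>t\<close>. Applying \<open>f\<close>, which kills \<open>k l\<close>, shows that its
    coefficient of \<open>k j\<close> is about \<open>s * c\<close>.\<close>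
  define c where "c = - (\<beta> (d l) * f w) / \<alpha> (d l)"
  define C' where "C' = C + B * (3 * C) * norm (k j)"
  have shift: "norm (H (x0 + s *\<^sub>R x) - H (x0 + (s * \<alpha> x) *\<^sub>R d j) - (s * \<beta> x) *\<^sub>R w) \<le> C" for s x
  proof -
    have "x0 + s *\<^sub>R x = x0 + s *\<^sub>R (\<alpha> x *\<^sub>R d j + \<beta> x *\<^sub>R t)"
      using decomp[of x] by (rule arg_cong)
    also have "\<dots> = (x0 + (s * \<alpha> x) *\<^sub>R d j) + (s * \<beta> x) *\<^sub>R t" by (simp add: algebra_simps)
    finally have eq: "x0 + s *\<^sub>R x = (x0 + (s * \<alpha> x) *\<^sub>R d j) + (s * \<beta> x) *\<^sub>R t" .
    show ?thesis unfolding eq by (rule period)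
  qed
  have along: "norm (H (x0 + s *\<^sub>R d j) - H x0 - (s * c) *\<^sub>R k j) \<le> C'" for s
  proof -
    define s' where "s' = s / \<alpha> (d l)"
    have s': "s' * \<alpha> (d l) = s" using \<alpha>l by (simp add: s'_def)
    obtain m where m: "norm (H (x0 + s' *\<^sub>R d l) - H x0 - m *\<^sub>R k l) \<le> C" using bars by blast
    obtain n where n: "norm (H (x0 + s *\<^sub>R d j) - H x0 - n *\<^sub>R k j) \<le> C" using bars by blast
    have h: "norm (H (x0 + s' *\<^sub>R d l) - H (x0 + s *\<^sub>R d j) - (s' * \<beta> (d l)) *\<^sub>R w) \<le> C"
      using shift[of s' "d l"] by (simp add: s')
    let ?v = "m *\<^sub>R k l - n *\<^sub>R k j - (s' * \<beta> (d l)) *\<^sub>R w"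
    have "?v = (H (x0 + s' *\<^sub>R d l) - H (x0 + s *\<^sub>R d j) - (s' * \<beta> (d l)) *\<^sub>R w)
      - (H (x0 + s' *\<^sub>R d l) - H x0 - m *\<^sub>R k l) + (H (x0 + s *\<^sub>R d j) - H x0 - n *\<^sub>R k j)" by simp
    also have "norm \<dots> \<le> C + C + C" by (rule norm_sum3_le(1)[OF h m n])
    finally have v: "norm ?v \<le> 3 * C" by simp
    have "f ?v = - n - s' * \<beta> (d l) * f w"
      by (simp add: linear_diff[OF f(1)] linear_scale[OF f(1)] f(2,3))
    also have "\<dots> = s * c - n" using \<alpha>l by (simp add: c_def s'_def field_simps)
    finally have "\<bar>s * c - n\<bar> \<le> B * (3 * C)"
      using B(2)[of ?v] mult_left_mono[OF v B(1)] by simp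
    then have "norm ((n - s * c) *\<^sub>R k j) \<le> B * (3 * C) * norm (k j)"
      by (simp add: abs_minus_commute mult_right_mono)
    moreover have "H (x0 + s *\<^sub>R d j) - H x0 - (s * c) *\<^sub>R k j =
      (H (x0 + s *\<^sub>R d j) - H x0 - n *\<^sub>R k j) + (n - s * c) *\<^sub>R k j" by (simp add: algebra_simps)
    ultimately show ?thesis using n unfolding C'_def by (metis add_mono norm_triangle_le)
  qed
  \<comment> \<open>The linear map that \<open>H\<close> follows up to bounded error: it sends
    \<open>t\<close> to \<open>w\<close> and \<open>d j\<close> to
    \<open>c *\<^sub>R k j\<close>.\<close>
  define g where "g x = (\<alpha> x * c) *\<^sub>R k j + \<beta> x *\<^sub>R w" for x
  have "linear g"
    by (rule linearI) (simp_all add: g_def \<alpha>_def \<beta>_def algebra_simps add_divide_distrib)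
  moreover have "\<exists>\<mu>. g (d i) = \<mu> *\<^sub>R k i" for i
  proof (rule multiples_near_line[OF k_nz])
    fix s
    obtain m where m: "norm (H (x0 + s *\<^sub>R d i) - H x0 - m *\<^sub>R k i) \<le> C" using bars by blast
    have "s *\<^sub>R g (d i) - m *\<^sub>R k i = (H (x0 + s *\<^sub>R d i) - H x0 - m *\<^sub>R k i)
      - (H (x0 + s *\<^sub>R d i) - H (x0 + (s * \<alpha> (d i)) *\<^sub>R d j) - (s * \<beta> (d i)) *\<^sub>R w)
      - (H (x0 + (s * \<alpha> (d i)) *\<^sub>R d j) - H x0 - ((s * \<alpha> (d i)) * c) *\<^sub>R k j)"
      by (simp add: g_def algebra_simps)
    also have "norm \<dots> \<le> C + C + C'" by (rule norm_sum3_le(2)[OF m shift along])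
    finally show "\<exists>l. norm (s *\<^sub>R g (d i) - l *\<^sub>R k i) \<le> C + C + C'" by blast
  qed
  ultimately have "g t = 0" by (rule no_deformation)
  moreover have "g t = w" using jl(2) by (simp add: g_def \<alpha>_def \<beta>_def)
  ultimately show False using assms(2) by simp
qed

end

section \<open>Tilings by the decorated tiles\<close>

locale fine_tiling = fine_slope +
  fixes \<T> :: "(real^2) set set" and s :: "real^4"
  assumes \<T>_eq: "\<T> = projected_tiles ((+) s ` E) \<pi>"
    and \<T>_tiling: "projects_to_tiling ((+) s ` E) \<pi>"
begin

lemma original_tile:
  assumes "B \<in> \<T>"
  obtains x i j where "x \<in> integer_lattice" "i \<noteq> j" "B = (+) (\<pi> x) ` \<pi> ` two_face 0 i j"
    "two_face x i j \<subseteq> {y + c | y c. y \<in> (+) s ` E \<and> c \<in> unit_cube}"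
proof -
  obtain x i j where *: "x \<in> integer_lattice" "i \<noteq> j" "B = \<pi> ` two_face x i j"
    "two_face x i j \<subseteq> {y + c | y c. y \<in> (+) s ` E \<and> c \<in> unit_cube}"
    using assms unfolding \<T>_eq projected_tiles_def selected_faces_def by blast
  have "B = (+) (\<pi> x) ` \<pi> ` two_face 0 i j"
    using *(3) two_face_translate[of x 0 i j] by (simp add: image_image \<pi>_simps)
  then show ?thesis using that * by blast
qed

sublocale orig: parallelogram_tiling \<pi> \<T>
proof (rule parallelogram_tiling.intro)
  show "plane_tiling \<T>" using \<T>_tiling by (simp add: projects_to_tiling_def \<T>_eq)
  show "\<exists>\<tau> i j. i \<noteq> j \<and> A = (+) \<tau> ` \<pi> ` two_face 0 i j" if "A \<in> \<T>" for A
    using that by (rule original_tile) blast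
qed (rule linear_\<pi>, rule \<pi>_axis_cross)

lemma original_vertex:
  assumes "y \<in> tiling_vertices \<T>"
  obtains m where "m \<in> integer_lattice" "y = \<pi> m"
    "m \<in> {y + c | y c. y \<in> (+) s ` E \<and> c \<in> unit_cube}"
proof -
  obtain B where B: "B \<in> \<T>" "y extreme_point_of B" using assms by (auto simp: tiling_vertices_def)
  obtain x i j where x: "x \<in> integer_lattice" "i \<noteq> j" "B = (+) (\<pi> x) ` \<pi> ` two_face 0 i j"
    "two_face x i j \<subseteq> {y + c | y c. y \<in> (+) s ` E \<and> c \<in> unit_cube}"
    by (rule original_tile[OF B(1)])
  obtain a b where ab: "a \<in> {0, 1}" "b \<in> {0, 1}" "y = \<pi> x + \<pi> (a *\<^sub>R axis i 1 + b *\<^sub>R axis j 1)"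
    using orig.extreme_corner[OF _ x(2)] B(2) unfolding x(3) orig.image_two_face by metis
  let ?m = "x + a *\<^sub>R axis i 1 + b *\<^sub>R axis j 1"
  have "?m \<in> two_face x i j" by (rule two_faceI) (use ab in auto)
  moreover have "?m \<in> integer_lattice" using x(1) ab by (auto simp: integer_lattice_def axis_def)
  moreover have "y = \<pi> ?m" using ab(3) by (simp add: \<pi>_simps add.assoc)
  ultimately show ?thesis using that x(4) by blast
qed

text \<open>Vertices lift into a unit-cube thickening of a translate of \<open>E\<close>. As \<psi>
  kills \<open>E\<close>, only the difference of two cube points counts, each of norm at most
  4.\<close>

lemma original_vertex_difference:
  obtains C where "\<And>y y'. y \<in> tiling_vertices \<T> \<Longrightarrow> y' \<in> tiling_vertices \<T> \<Longrightarrow>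
    \<exists>m. m \<in> integer_lattice \<and> y - y' = \<pi> m \<and> norm (\<psi> m) \<le> C"
proof -
  obtain B where B: "B \<ge> 0" "\<And>x. norm (\<psi> x) \<le> B * norm x" using linear_bound[OF linear_\<psi>] by blast
  have "\<exists>m. m \<in> integer_lattice \<and> y - y' = \<pi> m \<and> norm (\<psi> m) \<le> B * 8"
    if y: "y \<in> tiling_vertices \<T>" and y': "y' \<in> tiling_vertices \<T>" for y y'
  proof -
    obtain m e c where m: "m \<in> integer_lattice" "y = \<pi> m" "m = s + e + c" "e \<in> E" "c \<in> unit_cube"
      by (rule original_vertex[OF y]) auto
    obtain m' e' c' where m': "m' \<in> integer_lattice" "y' = \<pi> m'" "m' = s + e' + c'" "e' \<in> E" "c' \<in> unit_cube"
      by (rule original_vertex[OF y']) auto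
    have "\<psi> (m - m') = \<psi> ((e - e') + (c - c'))" by (simp add: m(3) m'(3) algebra_simps)
    also have "\<dots> = \<psi> (c - c')" using m m' by (simp only: \<psi>_simps(1) \<psi>_E subspace_diff[OF subspace_E] add_0)
    finally have "norm (\<psi> (m - m')) \<le> B * norm (c - c')" using B(2) by simp
    also have "\<dots> \<le> B * (4 + 4)"
      by (rule mult_left_mono[OF _ B(1)]) (intro norm_triangle_le_diff add_mono norm_unit_cube m(5) m'(5))
    finally have "norm (\<psi> (m - m')) \<le> B * 8" by simp
    moreover have "y - y' = \<pi> (m - m')" using m(2) m'(2) by (simp add: \<pi>_simps)
    ultimately show ?thesis using integer_lattice_diff[OF m(1) m'(1)] by blast
  qed
  then show ?thesis by (rule that)
qed

text \<open>The original tiling with its own decorations works: at each point of a drawn line some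
  tile contains a second point of the line, so it carries a proper segment there.\<close>

lemma exists_decorated_tiling:
  "decorated_tiling (FP_tileset p \<pi> \<T>) (decorate d \<T> ` \<T>)"
proof -
  have "fst ` decorate d \<T> ` \<T> = \<T>" by (simp add: image_image decorate_def)
  moreover have "inj_on fst (decorate d \<T> ` \<T>)" by (auto simp: inj_on_def decorate_def)
  moreover have "translate_decorated 0 A = A" for A
    by (simp add: translate_decorated_def)
  moreover have "ammann_bar_rule (decorate d \<T> ` \<T>)"
    unfolding ammann_bar_rule_def
  proof (intro ballI)
    fix A S assume "A \<in> decorate d \<T> ` \<T>" "S \<in> snd A"
    then obtain T L where T: "T \<in> \<T>" "L \<in> vertex_lines d \<T>" "\<nexists>x. L \<inter> T \<subseteq> {x}" "S = L \<inter> T"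
      by (auto simp: decorate_def)
    obtain x i where L: "L = {x + t *\<^sub>R d i | t. True}" using T(2) unfolding vertex_lines_def by blast
    obtain y y' where y: "y \<in> S" "y' \<in> S" "y \<noteq> y'" using T(3,4) by blast
    have hull: "affine hull S = L"
      unfolding L by (rule affine_hull_line[OF _ y]) (use T(4) L in auto)
    show "affine hull S = \<Union>{S'. (\<exists>B\<in>decorate d \<T> ` \<T>. S' \<in> snd B) \<and> S' \<subseteq> affine hull S}"
    proof
      show "affine hull S \<subseteq> \<Union>{S'. (\<exists>B\<in>decorate d \<T> ` \<T>. S' \<in> snd B) \<and> S' \<subseteq> affine hull S}"
      proof
        fix z assume z: "z \<in> affine hull S"
        then obtain a where a: "z = x + a *\<^sub>R d i" using hull L by blast
        obtain T' r where T': "T' \<in> \<T>" "z \<in> T'" "r \<noteq> 0" "z + r *\<^sub>R d i \<in> T'"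
          using orig.tile_in_direction[OF d_nz] by metis
        have "z + r *\<^sub>R d i = x + (a + r) *\<^sub>R d i" by (simp add: a algebra_simps)
        then have "z + r *\<^sub>R d i \<in> L" unfolding L by blast
        moreover have "z \<in> L" using z hull by simp
        moreover have "z + r *\<^sub>R d i \<noteq> z" using T'(3) d_nz by simp
        ultimately have "\<nexists>x. L \<inter> T' \<subseteq> {x}" using T' by blast
        then have "L \<inter> T' \<in> snd (decorate d \<T> T')" using T(2) by (auto simp: decorate_def)
        moreover have "L \<inter> T' \<subseteq> affine hull S" using hull by simp
        ultimately show "z \<in> \<Union>{S'. (\<exists>B\<in>decorate d \<T> ` \<T>. S' \<in> snd B) \<and> S' \<subseteq> affine hull S}"
          using T'(1,2) \<open>z \<in> L\<close> by blast
      qed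
    qed blast
  qed
  ultimately show ?thesis
    using orig.tiling unfolding decorated_tiling_def FP_tileset_def by metis
qed

lemma decorated_tile:
  assumes "decorated_tiling (FP_tileset p \<pi> \<T>) \<D>" "A \<in> \<D>"
  obtains B \<tau> where "B \<in> \<T>" "A = translate_decorated \<tau> (decorate d \<T> B)" "fst A = (+) \<tau> ` B"
proof -
  obtain B \<tau> where "B \<in> \<T>" "A = translate_decorated \<tau> (decorate d \<T> B)"
    using assms unfolding decorated_tiling_def FP_tileset_def by blast
  then show ?thesis using that by (simp add: translate_decorated_def decorate_def)
qed

lemma decorated_parallelogram_tiling:
  assumes D: "decorated_tiling (FP_tileset p \<pi> \<T>) \<D>"
  shows "parallelogram_tiling \<pi> (fst ` \<D>)"
proof (rule parallelogram_tiling.intro)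
  show "plane_tiling (fst ` \<D>)" using D by (simp add: decorated_tiling_def)
  fix A assume "A \<in> fst ` \<D>"
  then obtain A' where A': "A' \<in> \<D>" "A = fst A'" by blast
  obtain B \<tau> where B: "B \<in> \<T>" "fst A' = (+) \<tau> ` B" by (rule decorated_tile[OF D A'(1)])
  obtain \<tau>' i j where "i \<noteq> j" "B = (+) \<tau>' ` \<pi> ` two_face 0 i j" using orig.tiles[OF B(1)] by blast
  then have "i \<noteq> j" "A = (+) (\<tau> + \<tau>') ` \<pi> ` two_face 0 i j"
    using B(2) A'(2) by (simp_all add: image_image add.assoc)
  then show "\<exists>\<tau> i j. i \<noteq> j \<and> A = (+) \<tau> ` \<pi> ` two_face 0 i j" by blast
qed (rule linear_\<pi>, rule \<pi>_axis_cross)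

lemma segment_on_line:
  assumes B: "B \<in> \<T>" and S: "S \<in> snd (translate_decorated \<tau> (decorate d \<T> B))"
  obtains x i y y' where "x \<in> tiling_vertices \<T>" "S \<subseteq> {\<tau> + x + t *\<^sub>R d i | t. True}" "S \<subseteq> (+) \<tau> ` B"
    "y \<in> S" "y' \<in> S" "y \<noteq> y'"
proof -
  obtain L where L: "L \<in> vertex_lines d \<T>" "\<nexists>x. L \<inter> B \<subseteq> {x}" "S = (+) \<tau> ` (L \<inter> B)"
    using S by (auto simp: translate_decorated_def decorate_def)
  obtain x i where x: "x \<in> tiling_vertices \<T>" "L = {x + t *\<^sub>R d i | t. True}"
    using L(1) unfolding vertex_lines_def by blast
  obtain y y' where y: "y \<in> L \<inter> B" "y' \<in> L \<inter> B" "y \<noteq> y'" using L(2) by blast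
  have "S \<subseteq> {\<tau> + x + t *\<^sub>R d i | t. True}"
  proof
    fix z assume "z \<in> S"
    then obtain t where "z = \<tau> + (x + t *\<^sub>R d i)" using L(3) x(2) by blast
    then show "z \<in> {\<tau> + x + t *\<^sub>R d i | t. True}" by (auto simp: add.assoc)
  qed
  moreover have "S \<subseteq> (+) \<tau> ` B" using L(3) by blast
  moreover have "\<tau> + y \<in> S" "\<tau> + y' \<in> S" "\<tau> + y \<noteq> \<tau> + y'" using L(3) y by auto
  ultimately show ?thesis using that x(1) by blast
qed

text \<open>The segment found at \<open>x + r *\<^sub>R d i\<close> was drawn in \<T> through a
  vertex \<open>x'\<close> that may be far from \<open>B\<close>. Its translate
  \<open>\<tau> + x'\<close> lies on the bar but need not be a vertex of the new tiling.\<close>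

lemma bar_through_vertex:
  assumes D: "decorated_tiling (FP_tileset p \<pi> \<T>) \<D>" and x: "x \<in> tiling_vertices (fst ` \<D>)"
  obtains B \<tau> x' u where "B \<in> \<T>" "(+) \<tau> ` B \<in> fst ` \<D>" "x + r *\<^sub>R d i \<in> (+) \<tau> ` B"
    "x' \<in> tiling_vertices \<T>" "\<tau> + x' = x + u *\<^sub>R d i"
proof -
  interpret P: parallelogram_tiling \<pi> "fst ` \<D>" by (rule decorated_parallelogram_tiling[OF D])
  let ?L = "{x + t *\<^sub>R d i | t. True}"
  \<comment> \<open>A bar has to start at \<open>x\<close>: on this tile the line leaves a proper
    segment, and since the tiling is edge-to-edge, \<open>x\<close> is a vertex of this tile too, so
    the line is drawn on it.\<close>
  obtain A0 a where A0: "A0 \<in> fst ` \<D>" "x \<in> A0" "a \<noteq> 0" "x + a *\<^sub>R d i \<in> A0"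
    using P.tile_in_direction[OF d_nz] by metis
  obtain A1 where A1: "A1 \<in> fst ` \<D>" "x extreme_point_of A1" using x by (auto simp: tiling_vertices_def)
  have ext: "x extreme_point_of A0" by (rule P.extreme_common[OF A1(1) A0(1) A1(2) A0(2)])
  obtain A where A: "A \<in> \<D>" "fst A = A0" using A0(1) by blast
  obtain B \<tau> where B: "B \<in> \<T>" "A = translate_decorated \<tau> (decorate d \<T> B)" "fst A = (+) \<tau> ` B"
    by (rule decorated_tile[OF D A(1)])
  have "\<tau> + (x - \<tau>) extreme_point_of (+) \<tau> ` B" using ext A(2) B(3) by simp
  then have xB: "x - \<tau> extreme_point_of B" by (simp only: extreme_point_of_translation_eq)
  define L where "L = {x - \<tau> + t *\<^sub>R d i | t. True}"
  have L: "L \<in> vertex_lines d \<T>"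
    unfolding L_def vertex_lines_def using xB B(1) by (auto simp: tiling_vertices_def)
  have trans: "\<tau> + y \<in> ?L" if y: "y \<in> L" for y
  proof -
    obtain t where "y = x - \<tau> + t *\<^sub>R d i" using y unfolding L_def by blast
    then have "\<tau> + y = x + t *\<^sub>R d i" by simp
    then show ?thesis by blast
  qed
  have x0B: "x - \<tau> \<in> B" using xB by (simp add: extreme_point_of_def)
  have x1B: "x - \<tau> + a *\<^sub>R d i \<in> B"
    using A0(4) A(2) B(3) by (auto simp: algebra_simps)
  have "x - \<tau> + 0 *\<^sub>R d i \<in> L" and x1L: "x - \<tau> + a *\<^sub>R d i \<in> L" unfolding L_def by blast+
  then have x0L: "x - \<tau> \<in> L" by simp
  have "x - \<tau> \<noteq> x - \<tau> + a *\<^sub>R d i" using A0(3) d_nz by simp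
  then have "\<nexists>y. L \<inter> B \<subseteq> {y}" using x0B x1B x0L x1L by blast
  then have "L \<inter> B \<in> snd (decorate d \<T> B)" using L by (auto simp: decorate_def)
  then have S: "(+) \<tau> ` (L \<inter> B) \<in> snd A" unfolding B(2) translate_decorated_def by simp
  let ?S = "(+) \<tau> ` (L \<inter> B)"
  have "?S \<subseteq> ?L" using trans by blast
  moreover have "\<tau> + (x - \<tau>) \<in> ?S" "\<tau> + (x - \<tau> + a *\<^sub>R d i) \<in> ?S"
    using x0B x1B x0L x1L by blast+
  moreover have "\<tau> + (x - \<tau>) \<noteq> \<tau> + (x - \<tau> + a *\<^sub>R d i)" using A0(3) d_nz by simp
  ultimately have hull: "affine hull ?S = ?L" by (rule affine_hull_line)
  have "?L = \<Union>{S'. (\<exists>B\<in>\<D>. S' \<in> snd B) \<and> S' \<subseteq> ?L}"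
    using D S A(1) unfolding decorated_tiling_def ammann_bar_rule_def hull[symmetric] by blast
  then obtain S' A' where S': "A' \<in> \<D>" "S' \<in> snd A'" "S' \<subseteq> ?L" "x + r *\<^sub>R d i \<in> S'" by blast
  obtain B' \<tau>' where B': "B' \<in> \<T>" "A' = translate_decorated \<tau>' (decorate d \<T> B')" "fst A' = (+) \<tau>' ` B'"
    by (rule decorated_tile[OF D S'(1)])
  obtain x' i' y y' where x': "x' \<in> tiling_vertices \<T>" "S' \<subseteq> {\<tau>' + x' + t *\<^sub>R d i' | t. True}"
    "S' \<subseteq> (+) \<tau>' ` B'" "y \<in> S'" "y' \<in> S'" "y \<noteq> y'"
    by (rule segment_on_line[OF B'(1)]) (use S'(2) B'(2) in auto)
  obtain b b' where b: "y = x + b *\<^sub>R d i" "y' = x + b' *\<^sub>R d i" using x'(4,5) S'(3) by blast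
  obtain e e' where e: "y = \<tau>' + x' + e *\<^sub>R d i'" "y' = \<tau>' + x' + e' *\<^sub>R d i'" using x'(2,4,5) by blast
  have diff: "(b - b') *\<^sub>R d i = (e - e') *\<^sub>R d i'"
  proof -
    have "(b - b') *\<^sub>R d i = y - y'" unfolding b by (simp add: algebra_simps)
    also have "\<dots> = (e - e') *\<^sub>R d i'" unfolding e by (simp add: algebra_simps)
    finally show ?thesis .
  qed
  have "b \<noteq> b'" using b x'(6) by auto
  \<comment> \<open>Two distinct points of \<open>S'\<close> lie on both lines, so the directions
    are parallel.\<close>
  have "i' = i"
  proof (rule ccontr)
    assume ne: "i' \<noteq> i"
    have "cross2 ((b - b') *\<^sub>R d i) (d i') = cross2 ((e - e') *\<^sub>R d i') (d i')" by (simp only: diff)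
    then show False using d_cross[of i i'] ne \<open>b \<noteq> b'\<close> by simp
  qed
  have "\<tau>' + x' = y - e *\<^sub>R d i'" using e(1) by simp
  also have "\<dots> = x + (b - e) *\<^sub>R d i" unfolding b(1) \<open>i' = i\<close> by (simp add: algebra_simps)
  finally have u: "\<tau>' + x' = x + (b - e) *\<^sub>R d i" .
  have mem: "(+) \<tau>' ` B' \<in> fst ` \<D>" using S'(1) B'(3) by (metis imageI)
  show ?thesis using that[OF B'(1) mem _ x'(1) u] x'(3) S'(4) by blast
qed

lemma not_periodic:
  assumes D: "decorated_tiling (FP_tileset p \<pi> \<T>) \<D>"
  shows "\<not> periodic \<D>"
proof
  assume "periodic \<D>"
  then obtain t where t: "t \<noteq> 0" "translate_decorated t ` \<D> = \<D>" by (auto simp: periodic_def)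
  interpret P: parallelogram_tiling \<pi> "fst ` \<D>" by (rule decorated_parallelogram_tiling[OF D])
  obtain A0 where A0: "A0 \<in> fst ` \<D>" using P.cover by blast
  obtain x0 where x0: "x0 extreme_point_of A0" using P.extreme_exists[OF A0] by blast
  interpret L: lifted_tiling \<pi> "fst ` \<D>" x0
    by unfold_locales (use inj_lattice A0 x0 in \<open>auto simp: tiling_vertices_def\<close>)
  have period: "(+) t ` A \<in> fst ` \<D>" if A: "A \<in> fst ` \<D>" for A
  proof -
    obtain A' where "A' \<in> \<D>" "A = fst A'" using A by blast
    then have "translate_decorated t A' \<in> \<D>" using t(2) by blast
    moreover have "fst (translate_decorated t A') = (+) t ` A"
      using \<open>A = fst A'\<close> by (simp add: translate_decorated_def)
    ultimately show ?thesis by (metis imageI)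
  qed
  have "t + x0 extreme_point_of (+) t ` A0" using x0 by (simp add: extreme_point_of_translation_eq)
  then have "t + x0 \<in> tiling_vertices (fst ` \<D>)" using period[OF A0] unfolding tiling_vertices_def by blast
  then obtain q where q: "q \<in> integer_lattice" "t + x0 = x0 + \<pi> q" using L.vertex_lattice by blast
  then have tq: "t = \<pi> q" by (simp add: add.commute)
  have "q \<noteq> 0" using tq t(1) by (auto simp: \<pi>_simps)
  have "q \<notin> E"
    using irrational q(1) \<open>q \<noteq> 0\<close> Ints_subset_Rats by (auto simp: totally_irrational_def integer_lattice_def)
  then have w: "\<psi> q \<noteq> 0" using \<psi>_eq_0 by blast
  obtain B where B: "B \<ge> 0" "\<And>x. norm (\<psi> x) \<le> B * norm x" using linear_bound[OF linear_\<psi>] by blast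
  obtain C where C: "\<And>z r. norm (L.point_lift (z + r *\<^sub>R t) - L.point_lift z - r *\<^sub>R q) \<le> C"
  proof (rule L.point_lift_period_real[OF period q(1) tq])
    fix C assume "\<And>z r. norm (L.point_lift (z + r *\<^sub>R t) - L.point_lift z - r *\<^sub>R q) \<le> C"
    then show ?thesis by (rule that)
  qed
  obtain C' where C': "\<And>y y'. y \<in> tiling_vertices \<T> \<Longrightarrow> y' \<in> tiling_vertices \<T> \<Longrightarrow>
    \<exists>m. m \<in> integer_lattice \<and> y - y' = \<pi> m \<and> norm (\<psi> m) \<le> C'"
    by (rule original_vertex_difference) blast
  define H where "H z = \<psi> (L.point_lift z)" for z
  have near: "norm (H z - \<psi> (L.lift y)) \<le> B * 4"
    if "A \<in> fst ` \<D>" "z \<in> A" "y extreme_point_of A" for A y z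
  proof -
    have "norm (\<psi> (L.point_lift z - L.lift y)) \<le> B * norm (L.point_lift z - L.lift y)" by (rule B(2))
    also have "\<dots> \<le> B * 4"
      using L.point_lift_near[OF that] B(1) by (intro mult_left_mono) (auto simp: dist_norm)
    finally show ?thesis by (simp add: H_def \<psi>_simps)
  qed
  \<comment> \<open>\<open>point_lift x0\<close> may use another vertex than \<open>x0\<close>, so
    \<open>H x0\<close> is only close to 0.\<close>
  have H0: "norm (H x0) \<le> B * 4"
  proof -
    have "x0 \<in> A0" using x0 by (simp add: extreme_point_of_def)
    from near[OF A0 this x0] show ?thesis by (simp add: L.lift_x0 linear_0[OF linear_\<psi>])
  qed
  show False
  proof (rule coarsely_linear_absurd[OF t(1) w])
    fix z r
    have "H (z + r *\<^sub>R t) - H z - r *\<^sub>R \<psi> q = \<psi> (L.point_lift (z + r *\<^sub>R t) - L.point_lift z - r *\<^sub>R q)"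
      by (simp add: H_def \<psi>_simps)
    also have "norm \<dots> \<le> B * C" by (rule order_trans[OF B(2) mult_left_mono[OF C B(1)]])
    finally show "norm (H (z + r *\<^sub>R t) - H z - r *\<^sub>R \<psi> q) \<le> max (B * C) (B * 4 + C' + B * 4)" by simp
  next
    fix i r
    have x0V: "x0 \<in> tiling_vertices (fst ` \<D>)" by (rule L.x0)
    obtain T \<tau> x' u where T: "T \<in> \<T>" "(+) \<tau> ` T \<in> fst ` \<D>" "x0 + r *\<^sub>R d i \<in> (+) \<tau> ` T"
      "x' \<in> tiling_vertices \<T>" "\<tau> + x' = x0 + u *\<^sub>R d i"
      by (rule bar_through_vertex[OF D x0V])
    obtain y where y: "y extreme_point_of (+) \<tau> ` T" using P.extreme_exists[OF T(2)] by blast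
    then have "\<tau> + (y - \<tau>) extreme_point_of (+) \<tau> ` T" by simp
    then have "y - \<tau> extreme_point_of T" by (simp only: extreme_point_of_translation_eq)
    then have "y - \<tau> \<in> tiling_vertices \<T>" using T(1) by (auto simp: tiling_vertices_def)
    \<comment> \<open>Subtracting \<open>m\<close> from the lift of \<open>y\<close> passes to the
      virtual vertex \<open>\<tau> + x'\<close> on the bar, at a cost in \<psi> of at most
      \<open>C'\<close>; there \<open>lattice_parallel\<close> applies.\<close>
    then obtain m where m: "m \<in> integer_lattice" "y - \<tau> - x' = \<pi> m" "norm (\<psi> m) \<le> C'"
      using C'[OF _ T(4)] by blast
    have yV: "y \<in> tiling_vertices (fst ` \<D>)" using T(2) y unfolding tiling_vertices_def by blast
    have "\<pi> (L.lift y - m) = (y - x0) - (y - \<tau> - x')"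
      using L.lift(2)[OF yV] m(2) by (simp add: \<pi>_simps algebra_simps)
    also have "\<dots> = u *\<^sub>R d i" using T(5) by (simp add: algebra_simps)
    finally have "cross2 (d i) (\<pi> (L.lift y - m)) = 0" by simp
    then obtain \<rho> c where c: "L.lift y - m = \<rho> *\<^sub>R p i + c *\<^sub>R axis i 1"
      by (rule lattice_parallel[OF integer_lattice_diff[OF L.lift(1)[OF yV] m(1)]])
    have "\<psi> (L.lift y) = \<psi> m + \<psi> (L.lift y - m)" by (simp add: \<psi>_simps)
    also have "\<psi> (L.lift y - m) = (- c * \<kappa> i) *\<^sub>R k i"
      unfolding c by (simp add: \<psi>_simps \<psi>_E[OF p_mem] \<psi>_axis)
    finally have "H (x0 + r *\<^sub>R d i) - H x0 - (- c * \<kappa> i) *\<^sub>R k i =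
      (H (x0 + r *\<^sub>R d i) - \<psi> (L.lift y)) + \<psi> m - H x0" by simp
    also have "norm \<dots> \<le> B * 4 + C' + B * 4" by (rule norm_sum3_le(3)[OF near[OF T(2,3) y] m(3) H0])
    finally show "\<exists>l. norm (H (x0 + r *\<^sub>R d i) - H x0 - l *\<^sub>R k i) \<le> max (B * C) (B * 4 + C' + B * 4)"
      by (meson max.coboundedI2)
  qed
qed

end

section \<open>Injectivity on the slope and the theorem\<close>

text \<open>If \<pi> killed a nonzero vector of \<open>E\<close>, the image of \<open>E\<close>
  would lie in a line and all tiles in a strip around a parallel of it, so they could not cover the
  plane.\<close>

lemma projection_injective:
  assumes E: "two_plane E" and lin: "linear \<pi>" and tiling: "projects_to_tiling ((+) s ` E) \<pi>"
    and v: "v \<in> E" "\<pi> v = 0"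
  shows "v = 0"
proof -
  have sub: "subspace E" and dim: "dim E = 2" using E by (auto simp: two_plane_def)
  have "dim (\<pi> ` E) = 2"
  proof (rule ccontr)
    assume "dim (\<pi> ` E) \<noteq> 2"
    moreover have "dim (\<pi> ` E) \<le> 2" using dim_image_le[OF lin, of E] dim by simp
    ultimately have "dim (\<pi> ` E) < DIM(real^2)" by simp
    then obtain a where a: "a \<noteq> 0" "span (\<pi> ` E) \<subseteq> {x. a \<bullet> x = 0}"
      using lowdim_subset_hyperplane by blast
    have "linear (\<lambda>x. a \<bullet> \<pi> x)"
      by (rule linearI) (simp_all add: linear_add[OF lin] linear_scale[OF lin] inner_add_right)
    then obtain B where B: "B \<ge> 0" "\<And>x. norm (a \<bullet> \<pi> x) \<le> B * norm x" by (rule linear_bound) blast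
    define M where "M = \<bar>a \<bullet> \<pi> s\<bar> + B * 4"
    have "\<bar>a \<bullet> z\<bar> \<le> M" for z
    proof -
      have "z \<in> \<Union>(projected_tiles ((+) s ` E) \<pi>)"
        using tiling by (simp add: projects_to_tiling_def plane_tiling_def)
      then obtain x i j y where "y \<in> two_face x i j" "z = \<pi> y"
        "two_face x i j \<subseteq> {y + c | y c. y \<in> (+) s ` E \<and> c \<in> unit_cube}"
        unfolding projected_tiles_def selected_faces_def by blast
      then obtain e c where y: "y = s + e + c" "e \<in> E" "c \<in> unit_cube" by blast
      have "a \<bullet> \<pi> e = 0" using a(2) y(2) span_base by blast
      then have "a \<bullet> z = a \<bullet> \<pi> s + a \<bullet> \<pi> c"
        by (simp add: \<open>z = \<pi> y\<close> y(1) linear_add[OF lin] inner_add_right)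
      moreover have "norm c \<le> 4" by (rule norm_unit_cube[OF y(3)])
      then have "\<bar>a \<bullet> \<pi> c\<bar> \<le> B * 4" using B(2)[of c] mult_left_mono[OF _ B(1)] by fastforce
      ultimately show ?thesis unfolding M_def by linarith
    qed
    from this[of "((M + 1) / (a \<bullet> a)) *\<^sub>R a"] show False using a(1) by simp
  qed
  moreover have "dim (\<pi> ` E) \<le> 1" if v0: "v \<noteq> 0"
  proof -
    obtain B where B: "{v} \<subseteq> B" "B \<subseteq> E" "independent B" "E \<subseteq> span B"
      using maximal_independent_subset_extend[of "{v}" E] v(1) v0 by auto
    have card: "card B = 2" using basis_card_eq_dim[OF B(2,4,3)] dim by simp
    then have fin: "finite B" using card.infinite by fastforce
    have "\<pi> ` B \<subseteq> insert 0 (\<pi> ` (B - {v}))" using v(2) by auto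
    then have "span (\<pi> ` B) \<subseteq> span (\<pi> ` (B - {v}))"
      by (metis span_insert_0 span_mono)
    then have "\<pi> ` E \<subseteq> span (\<pi> ` (B - {v}))"
      using B(4) linear_span_image[OF lin, of B] by blast
    then have "dim (\<pi> ` E) \<le> card (\<pi> ` (B - {v}))" using fin by (intro dim_le_card) auto
    also have "\<dots> \<le> card (B - {v})" using fin by (intro card_image_le) auto
    also have "\<dots> = 1" using card B(1) fin by simp
    finally show ?thesis .
  qed
  ultimately show ?thesis by fastforce
qed

theorem theorem1:
  fixes E :: "(real^4) set"
    and p :: "4 \<Rightarrow> real^4"
    and \<pi> :: "real^4 \<Rightarrow> real^2"
    and \<T> :: "(real^2) set set"
  assumes "two_plane E"
    and "totally_irrational E"
    and "characterized_by_subperiods E p"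
    and "fine_projection E p \<pi>"
    and "\<T> \<in> cut_and_project_tilings E \<pi>"
  shows "aperiodic_tileset (FP_tileset p \<pi> \<T>)"
proof -
  obtain s where s: "\<T> = projected_tiles ((+) s ` E) \<pi>" "projects_to_tiling ((+) s ` E) \<pi>"
    using assms(5) by (auto simp: cut_and_project_tilings_def)
  have lin: "linear \<pi>" and axes: "\<And>i j. i \<noteq> j \<Longrightarrow> cross2 (\<pi> (axis i 1)) (\<pi> (axis j 1)) \<noteq> 0"
    and col: "\<And>i. cross2 (\<pi> (p i)) (\<pi> (axis i 1)) = 0"
    using assms(4) by (auto simp: fine_projection_def valid_projection_def collinear_iff_cross2)
  have sub: "subperiod E i (p i)" for i
    using assms(3) by (simp add: characterized_by_subperiods_def)
  have pE: "p i \<in> E" for i using sub by (simp add: subperiod_def)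
  \<comment> \<open>The condition in \<open>subperiod\<close> ranges over shifts that avoid the
    lattice; the shift \<open>s\<close> behind \<T> is one of them.\<close>
  have "prime_period (shadow i ((+) s ` E)) (omit_coord i (p i))" for i
    using sub[of i] s(2) by (simp add: subperiod_def projects_to_tiling_def)
  then have int: "omit_coord i (p i) \<in> integer_lattice"
    and gcd: "Gcd (range (\<lambda>k. \<lfloor>omit_coord i (p i) $ k\<rfloor>)) = 1" for i
    by (auto simp: prime_period_def)
  have inj: "v = 0" if "v \<in> E" "\<pi> v = 0" for v
    by (rule projection_injective[OF assms(1) lin s(2) that])
  have d_nz: "\<pi> (p i) \<noteq> 0" for i
  proof
    assume "\<pi> (p i) = 0"
    then have "p i = 0" using inj pE by blast
    then have "omit_coord i (p i) = 0" by (simp add: omit_coord_def vec_eq_iff)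
    then show False using gcd[of i] by simp
  qed
  have "\<exists>c. \<pi> (axis i 1) = c *\<^sub>R \<pi> (p i)" for i
    using cross2_eq_0D[OF col d_nz] by metis
  then obtain \<kappa> where \<kappa>: "\<And>i. \<pi> (axis i 1) = \<kappa> i *\<^sub>R \<pi> (p i)" by metis
  have \<kappa>_nz: "\<kappa> i \<noteq> 0" for i
  proof
    assume "\<kappa> i = 0"
    moreover obtain j where "j \<noteq> i" by (metis zero_neq_one)
    ultimately show False using axes[of i j] \<kappa>[of i] by simp
  qed
  have d_cross: "cross2 (\<pi> (p i)) (\<pi> (p j)) \<noteq> 0" if "i \<noteq> j" for i j
    using axes[OF that] by (auto simp: \<kappa>)
  have fin: "finite {E'. two_plane E' \<and>
      (\<exists>p'. \<forall>i. subperiod E' i (p' i) \<and> omit_coord i (p' i) = omit_coord i (p i))}"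
    using assms(3) by (simp add: characterized_by_subperiods_def)
  interpret fine_tiling E p \<pi> \<kappa> \<T> s
    by (intro fine_tiling.intro fine_slope.intro fine_tiling_axioms.intro)
      (fact assms(1) assms(2) fin lin pE int gcd \<kappa> \<kappa>_nz d_cross inj s)+
  show ?thesis
    unfolding aperiodic_tileset_def using exists_decorated_tiling not_periodic by blast
qed

end
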